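(* Let $F$ be a meromorphic Laplace pair $(f_l,f_r)$ of locally integrable functions on the vertical strip $\Omega_{a,b}$, $a<0<b$, with separatrix the imaginary axis $\Re(s)=0$, having finitely many poles, located on the imaginary axis at the distinct points $s=ip_n$, $p_n\in\mathbb{R}$, $1\le n\le N$, and satisfying the Phragmén–Lindelöf condition on $\Omega_{a,b}$. For each $n$, let $r_n$ denote the order of the pole $s=ip_n$ and let $$P_n(s)=\sum_{k=1}^{r_n}\frac{a_{n,k}}{(s-ip_n)^k}$$ be the principal part of the Laurent expansion of $F$ around $s=ip_n$. Then, for almost every $t\in\mathbb{R}$, $$f_r(t)-f_l(t)=\sum_{n=1}^{N}e^{ip_nt}\sum_{k=1}^{r_n}a_{n,k}\frac{t^{k-1}}{(k-1)!}.$$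
   Context: For $-\infty\le\alpha<\beta\le+\infty$ put $\Omega_{\alpha,\beta}=\{s\in\mathbb{C}:\alpha<\Re(s)<\beta\}$. For a locally integrable $f:\mathbb{R}\to\mathbb{C}$ the bilateral Laplace transform is $\mathcal{L}(f)(s)=\int_{-\infty}^{+\infty}e^{-st}f(t)\,dt$ (a convergent improper integral); it equals the Laplace–Stieltjes transform $\int_{-\infty}^{+\infty}e^{-st}\,d\mu(t)$ of $\mu(t)=\int_0^t f(u)\,du$. Laplace pair $(f_l,f_r)$ with separatrix $\Re(s)=0$: a function $F$, holomorphic or meromorphic on $\Omega_{a,b}$ with $a<0<b$, is a Laplace pair $(f_l,f_r)$ on $\Omega_{a,b}$ if $f_l,f_r$ are locally integrable, $F(s)=\mathcal{L}(f_l)(s)$ for all $s\in\Omega_{a,0}$ and $F(s)=\mathcal{L}(f_r)(s)$ for all $s\in\Omega_{0,b}$, the integrals converging there. (Hence all poles of $F$ in $\Omega_{a,b}$ lie on $\Re(s)=0$.) Phragmén–Lindelöf condition: a function $F$ meromorphic on $\Omega_{a,b}$ and continuous on the boundary satisfies it if there exist positive constants $A,B,Y$ and $0<K<\frac{\pi}{|b-a|}$ such that, for all $a<x<b$, $|F(x+iy)|\le A e^{Be^{K|y|}}$ whenever $|y|\ge Y$. *)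

theory Defs
  imports "HOL-Complex_Analysis.Complex_Analysis"
begin

definition vertical_strip :: "ereal \<Rightarrow> ereal \<Rightarrow> complex set" where
  "vertical_strip \<alpha> \<beta> = {s. \<alpha> < ereal (Re s) \<and> ereal (Re s) < \<beta>}"

definition locally_integrable :: "(real \<Rightarrow> complex) \<Rightarrow> bool" where
  "locally_integrable f \<longleftrightarrow> (\<forall>x y. set_integrable lebesgue {x..y} f)"

text \<open>
  The bilateral Laplace integral is an improper integral, possibly only conditionally
  convergent: the two endpoints tend to \<open>-\<infinity>\<close> and \<open>+\<infinity>\<close> independently of each other
  (so it is not a principal value).
\<close>

definition has_bilateral_laplace :: "(real \<Rightarrow> complex) \<Rightarrow> complex \<Rightarrow> complex \<Rightarrow> bool" where
  "has_bilateral_laplace f s L \<longleftrightarrow>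
     ((\<lambda>(A, B). LINT t:{A..B}|lebesgue. exp (- s * complex_of_real t) * f t) \<longlongrightarrow> L)
       (at_bot \<times>\<^sub>F at_top)"

definition meromorphic_laplace_pair ::
  "(complex \<Rightarrow> complex) \<Rightarrow> (real \<Rightarrow> complex) \<Rightarrow> (real \<Rightarrow> complex) \<Rightarrow> ereal \<Rightarrow> ereal \<Rightarrow> bool" where
  "meromorphic_laplace_pair F f\<^sub>l f\<^sub>r a b \<longleftrightarrow>
     F meromorphic_on vertical_strip a b \<and>
     locally_integrable f\<^sub>l \<and> locally_integrable f\<^sub>r \<and>
     (\<forall>s\<in>vertical_strip a 0. has_bilateral_laplace f\<^sub>l s (F s)) \<and>
     (\<forall>s\<in>vertical_strip 0 b. has_bilateral_laplace f\<^sub>r s (F s))"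

text \<open>
  The bounds \<open>a\<close>, \<open>b\<close> may formally be infinite, but then \<open>pi / \<bar>b - a\<bar> = 0\<close> and no
  \<open>K\<close> exists, so the condition can only hold on strips of finite width.
\<close>

definition phragmen_lindelof :: "(complex \<Rightarrow> complex) \<Rightarrow> ereal \<Rightarrow> ereal \<Rightarrow> bool" where
  "phragmen_lindelof F a b \<longleftrightarrow>
     F meromorphic_on vertical_strip a b \<and>
     (\<forall>z\<in>frontier (vertical_strip a b). continuous (at z within closure (vertical_strip a b)) F) \<and>
     (\<exists>A B Y K :: real. A > 0 \<and> B > 0 \<and> Y > 0 \<and> 0 < K \<and> ereal K < ereal pi / \<bar>b - a\<bar> \<and>
        (\<forall>x y :: real. a < ereal x \<and> ereal x < b \<and> \<bar>y\<bar> \<ge> Y \<longrightarrow>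
           norm (F (Complex x y)) \<le> A * exp (B * exp (K * \<bar>y\<bar>))))"

end

theory Submission
  imports Defs "HOL-Real_Asymp.Real_Asymp"
begin

text \<open>
  Write \<open>D = f\<^sub>r - f\<^sub>l\<close> and split every bilateral transform at \<open>t = 0\<close> into two half-line transforms;
  each of them converges, and is holomorphic, on a full half plane. Subtracting from \<open>F\<close> the transform of
  \<open>f\<^sub>r\<close> over \<open>(-\<infinity>, 0]\<close> and that of \<open>f\<^sub>l\<close> over \<open>[0, \<infinity>)\<close> leaves the transform of \<open>D\<close> over \<open>[0, \<infinity>)\<close>
  to the right of the separatrix, and minus the transform of \<open>D\<close> over \<open>(-\<infinity>, 0]\<close> to the left of it.
  After subtraction of the principal parts these pieces glue to an entire
  function \<open>G\<close>. It grows at most linearly off the imaginary axis (integration by parts) and hence, by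
  Phragmen-Lindelof, everywhere; being bounded on the positive real axis, it is constant. As the principal
  parts are the half-line transforms of the exponential polynomial, Lerch's uniqueness theorem on both
  half lines (which also excludes a nonzero constant) gives the claim, without any Fourier inversion.
\<close>

section \<open>Half-line Laplace transforms\<close>

text \<open>The given integrals may converge only conditionally. Integration by parts against the
  truncated integral at one point of convergence turns them into absolutely convergent integrals of
  a bounded continuous function, and half-plane convergence, holomorphy and growth all follow from
  that form. The resulting bound is a constant times
  \<open>norm (s - s\<^sub>0) / (Re s - Re s\<^sub>0)\<close>. It is linear at a fixed distance from
  the line through the base point \<open>s\<^sub>0\<close> but blows up near it. For the transforms
  of \<open>D\<close> convergence is known only up to the separatrix, so a strip around the axis
  remains in which growth has to come from the hypothesis on \<open>F\<close>. The two transforms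
  subtracted from \<open>F\<close> converge beyond the axis, so inside that strip they are
  holomorphic and grow at most linearly. On the ray to the right of a real base point the quotient
  equals 1, which gives boundedness on the positive real axis. The constant is excluded because a
  primitive starting at \<open>0\<close> vanishes there.\<close>

lemma exp_mult_absolutely_integrable:
  fixes f :: "real \<Rightarrow> complex"
  assumes "f absolutely_integrable_on {a..b}"
  shows "(\<lambda>t. exp (- s * complex_of_real t) * f t) absolutely_integrable_on {a..b}"
proof (rule absolutely_integrable_bounded_measurable_product[OF bilinear_times])
  have c: "continuous_on {a..b} (\<lambda>t. exp (- s * complex_of_real t))"
    by (intro continuous_intros)
  show "(\<lambda>t. exp (- s * complex_of_real t)) \<in> borel_measurable (lebesgue_on {a..b})"
    by (rule continuous_imp_measurable_on_sets_lebesgue[OF c]) auto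
  show "bounded ((\<lambda>t. exp (- s * complex_of_real t)) ` {a..b})"
    by (intro compact_imp_bounded compact_continuous_image c) auto
qed (use assms in auto)

text \<open>The difference quotient of \<open>E\<close> at \<open>x\<close> is at most
  \<open>L * \<bar>V y - V x\<bar>\<close>, which tends to \<open>0\<close> by continuity of
  \<open>V\<close>. So \<open>E\<close> has derivative \<open>0\<close> at every point, not merely
  almost everywhere, and is constant.\<close>

lemma zero_if_increment_bound:
  fixes E :: "real \<Rightarrow> complex" and V :: "real \<Rightarrow> real"
  assumes V: "continuous_on {0..T} V" and E0: "E 0 = 0"
    and le: "\<And>x y. 0 \<le> x \<Longrightarrow> x \<le> y \<Longrightarrow> y \<le> T \<Longrightarrow> norm (E y - E x) \<le> L * (y - x) * (V y - V x)"
    and L: "L \<ge> 0" and T: "T \<ge> 0"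
  shows "E T = 0"
proof -
  have "\<exists>c. \<forall>x\<in>{0..T}. E x = c"
  proof (rule has_derivative_zero_constant)
    fix x assume x: "x \<in> {0..T}"
    show "(E has_derivative (\<lambda>h. 0)) (at x within {0..T})"
      unfolding has_derivative_within
    proof (intro conjI)
      have "((\<lambda>y. L * \<bar>V y - V x\<bar>) \<longlongrightarrow> L * \<bar>V x - V x\<bar>) (at x within {0..T})"
        using V x by (intro tendsto_intros) (auto simp: continuous_on_def)
      then have lim: "((\<lambda>y. L * \<bar>V y - V x\<bar>) \<longlongrightarrow> 0) (at x within {0..T})" by simp
      show "((\<lambda>y. (1 / norm (y - x)) *\<^sub>R (E y - (E x + 0))) \<longlongrightarrow> 0) (at x within {0..T})"
      proof (rule Lim_null_comparison[OF _ lim])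
        show "\<forall>\<^sub>F y in at x within {0..T}.
          norm ((1 / norm (y - x)) *\<^sub>R (E y - (E x + 0))) \<le> L * \<bar>V y - V x\<bar>"
          unfolding eventually_at_filter
        proof (intro always_eventually allI impI)
          fix y assume ne: "y \<noteq> x" and y: "y \<in> {0..T}"
          have "norm (E y - E x) \<le> L * \<bar>y - x\<bar> * \<bar>V y - V x\<bar>"
          proof (cases "x \<le> y")
            case True
            then have "norm (E y - E x) \<le> L * (y - x) * (V y - V x)" using le x y by auto
            also have "\<dots> \<le> L * \<bar>y - x\<bar> * \<bar>V y - V x\<bar>"
              using L True mult_left_mono[of "V y - V x" "\<bar>V y - V x\<bar>" "L * (y - x)"] by simp
            finally show ?thesis .
          next
            case False
            then have "norm (E x - E y) \<le> L * (x - y) * (V x - V y)" using le x y by auto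
            also have "\<dots> \<le> L * \<bar>y - x\<bar> * \<bar>V y - V x\<bar>"
              using L False mult_left_mono[of "V x - V y" "\<bar>V y - V x\<bar>" "L * (x - y)"] by simp
            finally show ?thesis by (simp add: norm_minus_commute)
          qed
          then show "norm ((1 / norm (y - x)) *\<^sub>R (E y - (E x + 0))) \<le> L * \<bar>V y - V x\<bar>"
            using ne by (simp add: divide_le_eq mult_ac)
        qed
      qed
    qed (auto)
  qed auto
  then show ?thesis using E0 T by force
qed

text \<open>
  The primitive \<open>\<Phi>\<close> is differentiable only almost everywhere, so the difference \<open>E\<close> of the two sides is shown
  to have increments \<open>O((y - x) (V y - V x))\<close>, where \<open>V\<close> is the primitive of \<open>\<bar>g\<bar>\<close>.
\<close>

lemma laplace_by_parts:
  fixes g :: "real \<Rightarrow> complex" and w :: complex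
  assumes g: "g absolutely_integrable_on {0..T}" and T: "T \<ge> 0"
  defines "\<Phi> \<equiv> \<lambda>t. integral {0..t} g"
  shows "integral {0..T} (\<lambda>t. exp (- w * of_real t) * g t) =
    exp (- w * of_real T) * \<Phi> T + w * integral {0..T} (\<lambda>t. exp (- w * of_real t) * \<Phi> t)"
proof -
  define u where "u = (\<lambda>t::real. exp (- w * of_real t))"
  define u' where "u' = (\<lambda>t::real. - w * exp (- w * of_real t))"
  define V where "V = (\<lambda>t. integral {0..t} (\<lambda>t. norm (g t)))"
  define E where "E = (\<lambda>x. integral {0..x} (\<lambda>t. u t * g t) - u x * \<Phi> x
      + integral {0..x} (\<lambda>t. u' t * \<Phi> t))"
  have gi: "g integrable_on {0..T}" and ni: "(\<lambda>t. norm (g t)) integrable_on {0..T}"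
    using g by (auto simp: absolutely_integrable_on_def)
  have sub: "{x..y} \<subseteq> {0..T}" if "0 \<le> x" "y \<le> T" for x y using that by auto
  have gi': "g integrable_on {x..y}" and ni': "(\<lambda>t. norm (g t)) integrable_on {x..y}"
    and ga': "g absolutely_integrable_on {x..y}"
    if "0 \<le> x" "y \<le> T" for x y
    using integrable_on_subinterval[OF gi sub[OF that]] integrable_on_subinterval[OF ni sub[OF that]]
    by (auto simp: absolutely_integrable_on_def)
  have \<Phi>c: "continuous_on {0..T} \<Phi>" unfolding \<Phi>_def
    using indefinite_integral_continuous_1[OF gi] .
  have Vc: "continuous_on {0..T} V" unfolding V_def
    using indefinite_integral_continuous_1[OF ni] .
  have u'c: "continuous_on S u'" for S
    unfolding u'_def by (intro continuous_intros)
  have ud: "(u has_vector_derivative u' t) (at t within S)" for t S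
    unfolding u_def u'_def
    by (rule has_vector_derivative_eq_rhs, rule has_vector_derivative_real_field)
       (auto intro!: derivative_eq_intros)
  obtain L where L: "L \<ge> 0" "\<And>t. t \<in> {0..T} \<Longrightarrow> norm (u' t) \<le> L"
  proof -
    have "bounded (u' ` {0..T})"
      by (intro compact_imp_bounded compact_continuous_image u'c) auto
    then obtain L where "\<And>t. t \<in> {0..T} \<Longrightarrow> norm (u' t) \<le> L"
      unfolding bounded_iff by blast
    then show ?thesis using that[of "max L 0"] by (meson max.cobounded2 max.coboundedI1)
  qed
  have ulip: "norm (u t - u y) \<le> L * (y - x)" if "0 \<le> x" "x \<le> t" "t \<le> y" "y \<le> T" for x t y
  proof -
    have "norm (u t - u y) \<le> L * norm (t - y)"
    proof (rule differentiable_bound[of "{0..T}" u "\<lambda>t h. h *\<^sub>R u' t"])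
      fix t assume "t \<in> {0..T}"
      show "onorm (\<lambda>h. h *\<^sub>R u' t) \<le> L"
        by (rule onorm_le) (use L(2)[OF \<open>t \<in> {0..T}\<close>] in \<open>simp add: mult.commute[of L] mult_left_mono\<close>)
    qed (use ud that in \<open>auto simp: has_vector_derivative_def\<close>)
    also have "\<dots> \<le> L * (y - x)" using that L(1) by (intro mult_left_mono) auto
    finally show ?thesis .
  qed
  have "E T = 0"
  proof (rule zero_if_increment_bound[where L = "2 * L" and V = V])
    show "E 0 = 0" by (simp add: E_def \<Phi>_def)
    fix x y assume xy: "0 \<le> x" "x \<le> y" "y \<le> T"
    have uga: "(\<lambda>t. u t * g t) absolutely_integrable_on {a..b}" if "0 \<le> a" "b \<le> T" for a b
      unfolding u_def by (rule exp_mult_absolutely_integrable[OF ga'[OF that]])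
    have ug: "(\<lambda>t. u t * g t) integrable_on {a..b}" if "0 \<le> a" "b \<le> T" for a b
      by (rule set_lebesgue_integral_eq_integral(1)[OF uga[OF that]])
    have u\<Phi>: "(\<lambda>t. u' t * \<Phi> t) integrable_on {a..b}" if "0 \<le> a" "b \<le> T" for a b
      by (intro integrable_continuous_interval continuous_intros u'c continuous_on_subset[OF \<Phi>c] sub that)
    have i1: "integral {0..y} h - integral {0..x} h = integral {x..y} h"
      if "h integrable_on {0..y}" for h :: "real \<Rightarrow> 'z::banach"
      using Henstock_Kurzweil_Integration.integral_combine[of 0 x y h] xy that by (simp add: algebra_simps)
    have \<Phi>yx: "\<Phi> y - \<Phi> x = integral {x..y} g" unfolding \<Phi>_def using i1[OF gi'[of 0 y]] xy by simp
    have Vyx: "V y - V x = integral {x..y} (\<lambda>t. norm (g t))" unfolding V_def using i1[OF ni'[of 0 y]] xy by simp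
    have FTC: "(u' has_integral (u y - u x)) {x..y}"
      by (rule fundamental_theorem_of_calculus) (use xy ud in auto)
    \<comment> \<open>With \<open>u\<close> frozen at the right endpoint and \<open>\<Phi>\<close>
      at the left one, the two frozen integrals add up exactly to the boundary term
      \<open>u y * \<Phi> y - u x * \<Phi> x\<close>. What remains is a product of two small
      increments.\<close>
    have e1: "integral {x..y} (\<lambda>t. u y * g t) = u y * (\<Phi> y - \<Phi> x)"
      unfolding \<Phi>yx by (rule integral_mult_right)
    have e2: "integral {x..y} (\<lambda>t. u' t * \<Phi> x) = (u y - u x) * \<Phi> x"
      unfolding integral_unique[OF FTC, symmetric] by (rule integral_mult_left)
    have "E y - E x = integral {x..y} (\<lambda>t. u t * g t) - (u y * \<Phi> y - u x * \<Phi> x)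
        + integral {x..y} (\<lambda>t. u' t * \<Phi> t)"
      unfolding E_def using i1[OF ug[of 0 y]] i1[OF u\<Phi>[of 0 y]] xy by (simp add: algebra_simps)
    also have "\<dots> = (integral {x..y} (\<lambda>t. u t * g t) - integral {x..y} (\<lambda>t. u y * g t))
        + (integral {x..y} (\<lambda>t. u' t * \<Phi> t) - integral {x..y} (\<lambda>t. u' t * \<Phi> x))"
      unfolding e1 e2 by (simp add: algebra_simps)
    also have "integral {x..y} (\<lambda>t. u t * g t) - integral {x..y} (\<lambda>t. u y * g t)
       = integral {x..y} (\<lambda>t. (u t - u y) * g t)"
      unfolding left_diff_distrib
      by (rule Henstock_Kurzweil_Integration.integral_diff[symmetric])
         (intro integrable_on_mult_right ug gi' xy)+
    also have "integral {x..y} (\<lambda>t. u' t * \<Phi> t) - integral {x..y} (\<lambda>t. u' t * \<Phi> x)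
       = integral {x..y} (\<lambda>t. u' t * (\<Phi> t - \<Phi> x))"
      unfolding right_diff_distrib
      by (rule Henstock_Kurzweil_Integration.integral_diff[symmetric])
         (intro integrable_on_mult_left u\<Phi> has_integral_integrable[OF FTC] xy)+
    finally have eq: "E y - E x = integral {x..y} (\<lambda>t. (u t - u y) * g t)
       + integral {x..y} (\<lambda>t. u' t * (\<Phi> t - \<Phi> x))" .
    have a: "norm (integral {x..y} (\<lambda>t. (u t - u y) * g t)) \<le> integral {x..y} (\<lambda>t. L * (y - x) * norm (g t))"
    proof (rule integral_norm_bound_integral)
      show "(\<lambda>t. (u t - u y) * g t) integrable_on {x..y}"
        unfolding left_diff_distrib
        by (intro integrable_diff integrable_on_mult_right ug gi' xy)
      show "(\<lambda>t. L * (y - x) * norm (g t)) integrable_on {x..y}"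
        by (intro integrable_on_mult_right ni' xy)
      fix t assume "t \<in> {x..y}"
      then show "norm ((u t - u y) * g t) \<le> L * (y - x) * norm (g t)"
        unfolding norm_mult using ulip[of x t y] xy by (intro mult_right_mono) auto
    qed
    have b: "norm (integral {x..y} (\<lambda>t. u' t * (\<Phi> t - \<Phi> x))) \<le> L * (V y - V x) * (y - x)"
    proof (rule integral_bound)
      show "continuous_on {x..y} (\<lambda>t. u' t * (\<Phi> t - \<Phi> x))"
        by (intro continuous_intros u'c continuous_on_subset[OF \<Phi>c] sub xy)
      fix t assume t: "t \<in> {x..y}"
      have "\<Phi> t - \<Phi> x = integral {x..t} g" unfolding \<Phi>_def
        using Henstock_Kurzweil_Integration.integral_combine[of 0 x t g] t xy gi'[of 0 t]
        by (simp add: algebra_simps)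
      also have "norm \<dots> \<le> integral {x..t} (\<lambda>t. norm (g t))"
        by (rule integral_norm_bound_integral) (use gi'[of x t] ni'[of x t] t xy in auto)
      also have "\<dots> \<le> integral {x..y} (\<lambda>t. norm (g t))"
        by (rule integral_subset_le) (use ni'[of x t] ni'[of x y] t xy in auto)
      finally have "norm (\<Phi> t - \<Phi> x) \<le> V y - V x" using Vyx by simp
      then show "norm (u' t * (\<Phi> t - \<Phi> x)) \<le> L * (V y - V x)"
        unfolding norm_mult using L(1) L(2)[of t] t xy by (intro mult_mono) auto
    qed (use xy in auto)
    have "norm (E y - E x) \<le> L * (y - x) * (V y - V x) + L * (V y - V x) * (y - x)"
      unfolding eq using norm_triangle_mono[OF a b] Vyx by simp
    then show "norm (E y - E x) \<le> 2 * L * (y - x) * (V y - V x)" by (simp add: algebra_simps)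
  qed (use Vc L T in auto)
  moreover have "integral {0..T} (\<lambda>t. u' t * \<Phi> t) = - w * integral {0..T} (\<lambda>t. u t * \<Phi> t)"
    unfolding u'_def u_def integral_mult_right[symmetric] by (simp only: mult.assoc)
  ultimately show ?thesis
    unfolding E_def u_def by (simp add: algebra_simps)
qed

lemma laplace_tail:
  fixes \<Phi> :: "real \<Rightarrow> complex"
  assumes c: "continuous_on {0..} \<Phi>" and M: "\<And>t. t \<ge> 0 \<Longrightarrow> norm (\<Phi> t) \<le> M"
    and w: "Re w > 0" and T: "T \<ge> 0"
  shows "(\<lambda>t. exp (- w * of_real t) * \<Phi> t) integrable_on {T..}" (is ?int)
    and "norm (integral {T..} (\<lambda>t. exp (- w * of_real t) * \<Phi> t)) \<le> M * (exp (- Re w * T) / Re w)" (is ?bd)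
proof -
  have b: "((\<lambda>t. M * exp (- Re w * t)) has_integral M * (exp (- Re w * T) / Re w)) {T..}"
    by (intro has_integral_mult_right has_integral_exp_minus_to_infinity w)
  have le: "norm (exp (- w * of_real t) * \<Phi> t) \<le> M * exp (- Re w * t)" if "t \<in> {T..}" for t
    using M[of t] T that by (simp add: norm_mult mult.commute[of M] mult_left_mono)
  have co: "continuous_on {T..} (\<lambda>t. exp (- w * of_real t) * \<Phi> t)"
    using T by (intro continuous_intros continuous_on_subset[OF c]) auto
  have "(\<lambda>t. exp (- w * of_real t) * \<Phi> t) absolutely_integrable_on {T..}"
    by (rule measurable_bounded_by_integrable_imp_absolutely_integrable
          [OF continuous_imp_measurable_on_sets_lebesgue[OF co] _ has_integral_integrable[OF b] le]) auto
  then show ?int using set_lebesgue_integral_eq_integral(1) by blast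
  then show ?bd
    using integral_norm_bound_integral[OF _ has_integral_integrable[OF b] le] integral_unique[OF b] by simp
qed

lemma laplace_truncation_error:
  fixes \<Phi> :: "real \<Rightarrow> complex"
  assumes c: "continuous_on {0..} \<Phi>" and M: "\<And>t. t \<ge> 0 \<Longrightarrow> norm (\<Phi> t) \<le> M"
    and w: "Re w > 0" and T: "T \<ge> 0"
  shows "norm (integral {0..T} (\<lambda>t. exp (- w * of_real t) * \<Phi> t) -
      integral {0..} (\<lambda>t. exp (- w * of_real t) * \<Phi> t)) \<le> M * (exp (- Re w * T) / Re w)"
proof -
  have "integral ({0..T} \<union> {T..}) (\<lambda>t. exp (- w * of_real t) * \<Phi> t) =
      integral {0..T} (\<lambda>t. exp (- w * of_real t) * \<Phi> t) + integral {T..} (\<lambda>t. exp (- w * of_real t) * \<Phi> t)"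
  proof (rule Henstock_Kurzweil_Integration.integral_Un)
    have "{0..T} \<inter> {T..} = {T}" using T by auto
    then show "negligible ({0..T} \<inter> {T..})" by simp
    show "(\<lambda>t. exp (- w * of_real t) * \<Phi> t) integrable_on {0..T}"
      by (intro integrable_continuous_interval continuous_intros continuous_on_subset[OF c]) auto
  qed (use laplace_tail[OF assms] in auto)
  moreover have "{0..T} \<union> {T..} = {0..}" using T by auto
  ultimately show ?thesis using laplace_tail(2)[OF assms] by (simp add: norm_minus_commute)
qed

lemma laplace_truncation_tendsto:
  fixes \<Phi> :: "real \<Rightarrow> complex"
  assumes c: "continuous_on {0..} \<Phi>" and M: "\<And>t. t \<ge> 0 \<Longrightarrow> norm (\<Phi> t) \<le> M"
    and w: "Re w > 0"
  shows "((\<lambda>T. integral {0..T} (\<lambda>t. exp (- w * of_real t) * \<Phi> t)) \<longlongrightarrow>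
      integral {0..} (\<lambda>t. exp (- w * of_real t) * \<Phi> t)) at_top"
proof (rule Lim_transform)
  have "((\<lambda>T. M * (exp (- Re w * T) / Re w)) \<longlongrightarrow> 0) at_top" using w by real_asymp
  then show "((\<lambda>T. integral {0..T} (\<lambda>t. exp (- w * of_real t) * \<Phi> t) -
      integral {0..} (\<lambda>t. exp (- w * of_real t) * \<Phi> t)) \<longlongrightarrow> 0) at_top"
    by (rule Lim_null_comparison[rotated])
       (use laplace_truncation_error[OF assms] in \<open>auto intro: eventually_mono[OF eventually_ge_at_top[of 0]]\<close>)
qed simp

text \<open>The truncated integrals are holomorphic by differentiation under the integral sign. On a
  disc of radius \<open>Re z / 2\<close> around \<open>z\<close> the real part stays above that
  radius, so the truncation error is uniform and the limit is holomorphic.\<close>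

lemma laplace_continuous_holomorphic:
  fixes \<Phi> :: "real \<Rightarrow> complex"
  assumes c: "continuous_on {0..} \<Phi>" and M: "\<And>t. t \<ge> 0 \<Longrightarrow> norm (\<Phi> t) \<le> M"
  shows "(\<lambda>w. integral {0..} (\<lambda>t. exp (- w * of_real t) * \<Phi> t)) holomorphic_on {w. Re w > 0}"
proof (rule holomorphic_uniform_sequence)
  show "open {w. Re w > 0}" by (rule open_halfspace_Re_gt)
  fix n :: nat
  show "(\<lambda>w. integral {0..real n} (\<lambda>t. exp (- w * of_real t) * \<Phi> t)) holomorphic_on {w. Re w > 0}"
  proof (rule leibniz_rule_holomorphic[where a = 0 and b = "real n", unfolded box_real])
    show "((\<lambda>w. exp (- w * of_real t) * \<Phi> t) has_field_derivative - of_real t * exp (- w * of_real t) * \<Phi> t)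
        (at w within {w. Re w > 0})" for w t
      by (auto intro!: derivative_eq_intros)
    show "(\<lambda>t. exp (- w * of_real t) * \<Phi> t) integrable_on {0..real n}" for w
      by (intro integrable_continuous_interval continuous_intros continuous_on_subset[OF c]) auto
    show "continuous_on ({w. Re w > 0} \<times> {0..real n}) (\<lambda>(w, t). - of_real t * exp (- w * of_real t) * \<Phi> t)"
      unfolding case_prod_unfold
      by (intro continuous_intros continuous_on_compose2[OF c]) auto
  qed (rule convex_halfspace_Re_gt)
next
  fix z :: complex assume "z \<in> {w. Re w > 0}"
  define d where "d = Re z / 2"
  have d: "d > 0" using \<open>z \<in> _\<close> by (simp add: d_def)
  have Re: "Re w \<ge> d" if "w \<in> cball z d" for w
    using abs_Re_le_cmod[of "z - w"] that by (auto simp: dist_norm d_def)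
  have M0: "M \<ge> 0" using M[of 0] norm_ge_zero order.trans by blast
  have "uniform_limit (cball z d) (\<lambda>n w. integral {0..real n} (\<lambda>t. exp (- w * of_real t) * \<Phi> t))
           (\<lambda>w. integral {0..} (\<lambda>t. exp (- w * of_real t) * \<Phi> t)) sequentially"
  proof (rule uniform_limitI)
    fix e :: real assume "e > 0"
    have "(\<lambda>n. M * (exp (- d * real n) / d)) \<longlonglongrightarrow> 0" using d by real_asymp
    then have "\<forall>\<^sub>F n in sequentially. M * (exp (- d * real n) / d) < e"
      using \<open>e > 0\<close> by (rule order_tendstoD)
    then show "\<forall>\<^sub>F n in sequentially. \<forall>w\<in>cball z d. dist
        (integral {0..real n} (\<lambda>t. exp (- w * of_real t) * \<Phi> t))
        (integral {0..} (\<lambda>t. exp (- w * of_real t) * \<Phi> t)) < e"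
    proof eventually_elim
      case (elim n)
      show ?case
      proof
        fix w assume w: "w \<in> cball z d"
        have "dist (integral {0..real n} (\<lambda>t. exp (- w * of_real t) * \<Phi> t))
           (integral {0..} (\<lambda>t. exp (- w * of_real t) * \<Phi> t)) \<le> M * (exp (- Re w * real n) / Re w)"
          unfolding dist_norm using laplace_truncation_error[OF c M, of w "real n"] Re[OF w] d by simp
        also have "\<dots> \<le> M * (exp (- d * real n) / d)"
          using Re[OF w] d M0 by (intro mult_left_mono frac_le) (auto simp: mult_right_mono)
        finally show "dist (integral {0..real n} (\<lambda>t. exp (- w * of_real t) * \<Phi> t))
           (integral {0..} (\<lambda>t. exp (- w * of_real t) * \<Phi> t)) < e" using elim by simp
      qed
    qed
  qed
  moreover have "cball z d \<subseteq> {w. Re w > 0}" using Re d by force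
  ultimately show "\<exists>d>0. cball z d \<subseteq> {w. Re w > 0} \<and> uniform_limit (cball z d)
      (\<lambda>n w. integral {0..real n} (\<lambda>t. exp (- w * of_real t) * \<Phi> t))
           (\<lambda>w. integral {0..} (\<lambda>t. exp (- w * of_real t) * \<Phi> t)) sequentially"
    using d by blast
qed

definition laplace_trunc :: "(real \<Rightarrow> complex) \<Rightarrow> complex \<Rightarrow> real \<Rightarrow> complex" where
  "laplace_trunc f s T = integral {0..T} (\<lambda>t. exp (- s * of_real t) * f t)"

text \<open>A limit of truncations, in line with the improper integrals of the hypothesis. The value
  is unspecified where the limit does not exist, so convergence is always established
  alongside.\<close>

definition laplace :: "(real \<Rightarrow> complex) \<Rightarrow> complex \<Rightarrow> complex" where
  "laplace f s = Lim at_top (laplace_trunc f s)"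

lemma laplace_eqI: "(laplace_trunc f s \<longlongrightarrow> L) at_top \<Longrightarrow> laplace f s = L"
  unfolding laplace_def by (intro tendsto_Lim) auto

text \<open>Convergence at a single \<open>s\<close> is used only through this: the truncated
  integral is a continuous function of its endpoint, bounded on compact intervals by continuity and
  near infinity by convergence.\<close>

lemma laplace_trunc_bounded:
  assumes f: "\<And>T. f absolutely_integrable_on {0..T}"
    and lim: "(laplace_trunc f s \<longlongrightarrow> L) at_top"
  shows "continuous_on {0..} (laplace_trunc f s)" and "\<exists>M. \<forall>T\<ge>0. norm (laplace_trunc f s T) \<le> M"
proof -
  have i: "(\<lambda>t. exp (- s * of_real t) * f t) integrable_on {0..T}" for T
    using exp_mult_absolutely_integrable[OF f] set_lebesgue_integral_eq_integral(1) by blast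
  have ci: "continuous_on {0..T} (laplace_trunc f s)" for T
    unfolding laplace_trunc_def using indefinite_integral_continuous_1[OF i] .
  show "continuous_on {0..} (laplace_trunc f s)"
  proof (rule continuous_on_eq_continuous_within[THEN iffD2], intro ballI)
    fix x :: real assume x: "x \<in> {0..}"
    have "continuous (at x within {0..x+1}) (laplace_trunc f s)"
      using ci[of "x+1"] x by (auto simp: continuous_on_eq_continuous_within)
    moreover have "at x within {0..x+1} = at x within {0..}"
      by (rule at_within_nhd[of x "{..<x+1}"]) auto
    ultimately show "continuous (at x within {0..}) (laplace_trunc f s)" by (simp add: continuous_within)
  qed
  have "\<forall>\<^sub>F T in at_top. dist (laplace_trunc f s T) L < 1" using lim by (rule tendstoD) simp
  then obtain T0 where T0: "\<And>T. T \<ge> T0 \<Longrightarrow> dist (laplace_trunc f s T) L < 1"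
    by (auto simp: eventually_at_top_linorder)
  have "bounded (laplace_trunc f s ` {0..T0})"
    by (intro compact_imp_bounded compact_continuous_image ci) auto
  then obtain M where M: "\<forall>T\<in>{0..T0}. norm (laplace_trunc f s T) \<le> M" unfolding bounded_iff by blast
  have "norm (laplace_trunc f s T) \<le> max M (norm L + 1)" if "T \<ge> 0" for T
  proof (cases "T \<le> T0")
    case True then show ?thesis using M that by (simp add: le_max_iff_disj)
  next
    case False
    then have "norm (laplace_trunc f s T - L) < 1" using T0[of T] by (simp add: dist_norm)
    then show ?thesis using norm_triangle_sub[of "laplace_trunc f s T" L] by simp
  qed
  then show "\<exists>M. \<forall>T\<ge>0. norm (laplace_trunc f s T) \<le> M" by blast
qed

text \<open>The kernel at \<open>s\<close> is the kernel at \<open>s\<^sub>0\<close> times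
  \<open>exp (- (s - s\<^sub>0) * t)\<close>. Integrating by parts moves the derivative onto this
  decaying factor: the boundary term dies out, and the remaining integral has a bounded integrand
  times an exponential, hence converges absolutely.\<close>

lemma laplace_half_plane:
  assumes f: "\<And>T. f absolutely_integrable_on {0..T}"
    and lim: "(laplace_trunc f s\<^sub>0 \<longlongrightarrow> L) at_top" and s: "Re s > Re s\<^sub>0"
  shows "(laplace_trunc f s \<longlongrightarrow>
    (s - s\<^sub>0) * integral {0..} (\<lambda>t. exp (- (s - s\<^sub>0) * of_real t) * laplace_trunc f s\<^sub>0 t)) at_top"
proof -
  let ?w = "s - s\<^sub>0"
  have eq: "laplace_trunc f s T = exp (- ?w * of_real T) * laplace_trunc f s\<^sub>0 T +
      ?w * integral {0..T} (\<lambda>t. exp (- ?w * of_real t) * laplace_trunc f s\<^sub>0 t)" if "T \<ge> 0" for T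
    using laplace_by_parts[OF exp_mult_absolutely_integrable[OF f, where s = s\<^sub>0] that, of ?w]
    by (simp add: laplace_trunc_def mult.assoc[symmetric] exp_add[symmetric] algebra_simps)
  obtain M where M: "\<And>T. T \<ge> 0 \<Longrightarrow> norm (laplace_trunc f s\<^sub>0 T) \<le> M"
    using laplace_trunc_bounded(2)[OF f lim] by blast
  have "((\<lambda>T. exp (- Re ?w * T)) \<longlongrightarrow> 0) at_top" using s by real_asymp
  then have "((\<lambda>T. exp (- ?w * of_real T)) \<longlongrightarrow> 0) at_top"
    by (subst tendsto_norm_zero_iff[symmetric]) (simp add: algebra_simps)
  from tendsto_mult[OF this lim]
  have 1: "((\<lambda>T. exp (- ?w * of_real T) * laplace_trunc f s\<^sub>0 T) \<longlongrightarrow> 0) at_top" by simp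
  have "((\<lambda>T. exp (- ?w * of_real T) * laplace_trunc f s\<^sub>0 T +
      ?w * integral {0..T} (\<lambda>t. exp (- ?w * of_real t) * laplace_trunc f s\<^sub>0 t)) \<longlongrightarrow>
     0 + ?w * integral {0..} (\<lambda>t. exp (- ?w * of_real t) * laplace_trunc f s\<^sub>0 t)) at_top"
    by (intro tendsto_add 1 tendsto_mult tendsto_const
          laplace_truncation_tendsto[OF laplace_trunc_bounded(1)[OF f lim] M]) (use s in auto)
  then show ?thesis
    by (rule Lim_transform_eventually[OF tendsto_eq_rhs])
       (use eq in \<open>auto intro: eventually_mono[OF eventually_ge_at_top[of 0]]\<close>)
qed

lemma laplace_tendsto:
  assumes "\<And>T. f absolutely_integrable_on {0..T}"
    and "(laplace_trunc f s\<^sub>0 \<longlongrightarrow> L) at_top" and "Re s > Re s\<^sub>0"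
  shows "(laplace_trunc f s \<longlongrightarrow> laplace f s) at_top"
  using laplace_half_plane[OF assms] laplace_eqI by metis

text \<open>This one estimate serves twice: at a fixed distance from the line
  \<open>Re s = Re s\<^sub>0\<close> it gives linear growth, and on the horizontal ray to the right
  of \<open>s\<^sub>0\<close> it gives boundedness.\<close>

lemma laplace_bound:
  assumes f: "\<And>T. f absolutely_integrable_on {0..T}"
    and lim: "(laplace_trunc f s\<^sub>0 \<longlongrightarrow> L) at_top"
  obtains M where "M \<ge> 0"
    and "\<And>s. Re s > Re s\<^sub>0 \<Longrightarrow> norm (laplace f s) \<le> M * norm (s - s\<^sub>0) / (Re s - Re s\<^sub>0)"
proof -
  obtain M where M: "\<And>T. T \<ge> 0 \<Longrightarrow> norm (laplace_trunc f s\<^sub>0 T) \<le> M"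
    using laplace_trunc_bounded(2)[OF f lim] by blast
  have "norm (laplace f s) \<le> M * norm (s - s\<^sub>0) / (Re s - Re s\<^sub>0)" if s: "Re s > Re s\<^sub>0" for s
    unfolding laplace_eqI[OF laplace_half_plane[OF f lim s]] norm_mult
    using mult_left_mono[OF laplace_tail(2)[OF laplace_trunc_bounded(1)[OF f lim] M, of "s - s\<^sub>0" 0], of "norm (s - s\<^sub>0)"] s
    by (simp add: mult.commute)
  moreover have "M \<ge> 0" using M[of 0] norm_ge_zero order.trans by blast
  ultimately show ?thesis using that by blast
qed

lemma laplace_holomorphic:
  assumes f: "\<And>T. f absolutely_integrable_on {0..T}"
    and lim: "(laplace_trunc f s\<^sub>0 \<longlongrightarrow> L) at_top"
  shows "laplace f holomorphic_on {s. Re s > Re s\<^sub>0}"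
proof -
  obtain M where M: "\<And>T. T \<ge> 0 \<Longrightarrow> norm (laplace_trunc f s\<^sub>0 T) \<le> M"
    using laplace_trunc_bounded(2)[OF f lim] by blast
  have "(\<lambda>w. integral {0..} (\<lambda>t. exp (- w * of_real t) * laplace_trunc f s\<^sub>0 t)) \<circ> (\<lambda>s. s - s\<^sub>0)
     holomorphic_on {s. Re s > Re s\<^sub>0}"
    by (rule holomorphic_on_compose_gen[OF _ laplace_continuous_holomorphic[OF laplace_trunc_bounded(1)[OF f lim] M]])
       (auto intro!: holomorphic_intros)
  then have "(\<lambda>s. (s - s\<^sub>0) * integral {0..} (\<lambda>t. exp (- (s - s\<^sub>0) * of_real t) * laplace_trunc f s\<^sub>0 t))
     holomorphic_on {s. Re s > Re s\<^sub>0}"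
    unfolding o_def by (intro holomorphic_intros)
  then show ?thesis
    by (rule holomorphic_transform) (use laplace_eqI[OF laplace_half_plane[OF f lim]] in auto)
qed

section \<open>Uniqueness\<close>

text \<open>Under \<open>u = exp (- t)\<close> the hypothesis says that all moments of
  \<open>v u = \<phi> (- ln u)\<close> on the unit interval vanish. By Weierstrass \<open>v\<close>
  is then orthogonal to itself. The substitution serves only continuity and approximation; all
  integrals stay on the half line in \<open>t\<close>.\<close>

lemma lerch_continuous:
  fixes \<phi> :: "real \<Rightarrow> complex"
  assumes c: "continuous_on {0..} \<phi>" and lim: "(\<phi> \<longlongrightarrow> 0) at_top"
    and zero: "\<And>n::nat. integral {0..} (\<lambda>t. exp (- of_nat (Suc n) * of_real t) * \<phi> t) = 0"
    and t: "t \<ge> 0"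
  shows "\<phi> t = 0"
proof -
  \<comment> \<open>The value \<open>0\<close> at \<open>u = 0\<close> is the limit of
    \<open>\<phi>\<close> at infinity, so \<open>v\<close> is continuous on the closed interval, as
    Weierstrass requires.\<close>
  define v where "v u = (if u = 0 then 0 else \<phi> (- ln u))" for u :: real
  have vc: "continuous_on {0..1} v"
  proof (rule continuous_on_eq_continuous_within[THEN iffD2], intro ballI)
    fix u :: real assume u: "u \<in> {0..1}"
    show "continuous (at u within {0..1}) v"
    proof (cases "u = 0")
      case True
      have "filterlim (\<lambda>u::real. - ln u) at_top (at_right 0)" by real_asymp
      then have "((\<lambda>u. \<phi> (- ln u)) \<longlongrightarrow> 0) (at_right 0)" by (rule filterlim_compose[OF lim])
      then have "((\<lambda>u. \<phi> (- ln u)) \<longlongrightarrow> 0) (at 0 within {0..1})"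
        by (simp add: at_within_Icc_at_right)
      then have "(v \<longlongrightarrow> 0) (at 0 within {0..1})"
        by (rule Lim_transform_eventually) (auto simp: v_def eventually_at_filter)
      then show ?thesis using True by (simp add: continuous_within v_def)
    next
      case False
      have "continuous_on {0<..1} (\<lambda>u. \<phi> (- ln u))"
        by (intro continuous_on_compose2[OF c] continuous_intros) auto
      then have "continuous_on {0<..1} v"
        by (rule continuous_on_eq) (auto simp: v_def)
      moreover have "at u within {0<..1} = at u within {0..1}"
        by (rule at_within_nhd[of u "{0<..}"]) (use u False in auto)
      moreover have "u \<in> {0<..1}" using u False by simp
      ultimately show ?thesis
        by (metis continuous_on_eq_continuous_within continuous_within)
    qed
  qed
  have v_exp: "v (exp (- t)) = \<phi> t" for t by (simp add: v_def)
  have "bounded (v ` {0..1})" by (intro compact_imp_bounded compact_continuous_image vc) auto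
  then obtain M where M: "\<And>u. u \<in> {0..1} \<Longrightarrow> norm (v u) \<le> M" unfolding bounded_iff by blast
  have \<phi>M: "norm (\<phi> t) \<le> M" if "t \<ge> 0" for t using M[of "exp (- t)"] that by (simp add: v_exp)
  have M0: "M \<ge> 0" using \<phi>M[of 0] norm_ge_zero order.trans by blast
  \<comment> \<open>\<open>cnj \<circ> v\<close> is uniformly close to polynomials, which integrate to \<open>0\<close> against \<open>\<phi>\<close>; hence \<open>J = 0\<close>.\<close>
  define J where "J = integral {0..} (\<lambda>t. exp (- 1 * of_real t) * (\<phi> t * cnj (\<phi> t)))"
  have sqb: "norm (\<phi> t * cnj (\<phi> t)) \<le> M * M" if "t \<ge> 0" for t
    unfolding norm_mult complex_mod_cnj using \<phi>M[OF that] M0 by (intro mult_mono) auto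
  have Ji: "(\<lambda>t. exp (- 1 * of_real t) * (\<phi> t * cnj (\<phi> t))) integrable_on {0..}"
    by (rule laplace_tail[where M = "M * M"]) (use sqb in \<open>auto intro!: continuous_intros c\<close>)
  have poly0: "((\<lambda>t. exp (- 1 * of_real t) * (of_real (q (exp (- t))) * \<phi> t)) has_integral 0) {0..}"
    if q: "real_polynomial_function q" for q
  proof -
    obtain a n where an: "q = (\<lambda>x. \<Sum>i\<le>n. a i * x ^ i)"
      using q unfolding real_polynomial_function_iff_sum by blast
    have "((\<lambda>t. \<Sum>i\<le>n. of_real (a i) * (exp (- of_nat (Suc i) * of_real t) * \<phi> t)) has_integral
        (\<Sum>i\<le>n. of_real (a i) * 0)) {0..}"
    proof (intro has_integral_sum has_integral_mult_right)
      fix i assume "i \<in> {..n}"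
      show "((\<lambda>t. exp (- of_nat (Suc i) * of_real t) * \<phi> t) has_integral 0) {0..}"
        using laplace_tail(1)[OF c \<phi>M, of "of_nat (Suc i)" 0] zero[of i]
        by (simp add: has_integral_integrable_integral)
    qed auto
    moreover have "(\<Sum>i\<le>n. of_real (a i) * (exp (- of_nat (Suc i) * of_real t) * \<phi> t)) =
        exp (- 1 * of_real t) * (of_real (q (exp (- t))) * \<phi> t)" for t
      unfolding an of_real_sum sum_distrib_left sum_distrib_right
      by (intro sum.cong refl)
         (simp add: exp_of_nat_mult[symmetric] exp_of_real[symmetric] mult_exp_exp algebra_simps)
    ultimately show ?thesis by simp
  qed
  have "norm J \<le> e" if "e > 0" for e
  proof -
    \<comment> \<open>Real and imaginary part are approximated separately, each within
      \<open>d\<close>. The error in \<open>J\<close> is therefore at most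
      \<open>M * (2 * d)\<close>, which is below \<open>e\<close>; \<open>M + 1\<close> avoids
      division by zero.\<close>
    define d where "d = e / (2 * (M + 1))"
    have d: "d > 0" using that M0 by (simp add: d_def)
    obtain q1 where q1: "real_polynomial_function q1" "\<And>u. u \<in> {0..1} \<Longrightarrow> \<bar>Re (v u) - q1 u\<bar> < d"
      using Stone_Weierstrass_real_polynomial_function[of "{0..1::real}" "\<lambda>u. Re (v u)" d] vc d
      by (auto intro: continuous_intros)
    obtain q2 where q2: "real_polynomial_function q2" "\<And>u. u \<in> {0..1} \<Longrightarrow> \<bar>Im (v u) - q2 u\<bar> < d"
      using Stone_Weierstrass_real_polynomial_function[of "{0..1::real}" "\<lambda>u. Im (v u)" d] vc d
      by (auto intro: continuous_intros)
    define Q where "Q t = complex_of_real (q1 (exp (- t))) - \<i> * of_real (q2 (exp (- t)))" for t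
    have "((\<lambda>t. exp (- 1 * of_real t) * (of_real (q1 (exp (- t))) * \<phi> t)
        - \<i> * (exp (- 1 * of_real t) * (of_real (q2 (exp (- t))) * \<phi> t))) has_integral 0 - \<i> * 0) {0..}"
      by (intro has_integral_diff has_integral_mult_right poly0 q1 q2)
    then have Q0: "((\<lambda>t. exp (- 1 * of_real t) * (\<phi> t * Q t)) has_integral 0) {0..}"
      by (simp add: Q_def algebra_simps)
    have "((\<lambda>t. exp (- 1 * of_real t) * (\<phi> t * cnj (\<phi> t)) - exp (- 1 * of_real t) * (\<phi> t * Q t))
       has_integral J - 0) {0..}"
      unfolding J_def by (intro has_integral_diff Q0 integrable_integral Ji)
    then have J: "J = integral {0..} (\<lambda>t. exp (- 1 * of_real t) * (\<phi> t * (cnj (\<phi> t) - Q t)))"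
      by (simp add: integral_unique[symmetric] right_diff_distrib)
    have qc: "continuous_on S (\<lambda>t. q (exp (- t)))" if "real_polynomial_function q" for q and S :: "real set"
    proof (rule continuous_on_compose2[of UNIV q])
      show "continuous_on UNIV q"
        using that by (intro continuous_on_polymonial_function) (simp add: real_polynomial_function_eq)
      show "continuous_on S (\<lambda>t::real. exp (- t))" by (intro continuous_intros)
    qed simp
    have "norm J \<le> (M * (2 * d)) * (exp (- Re 1 * 0) / Re 1)"
      unfolding J
    proof (rule laplace_tail(2))
      show "continuous_on {0..} (\<lambda>t. \<phi> t * (cnj (\<phi> t) - Q t))"
        unfolding Q_def by (intro continuous_intros c qc q1 q2)
      fix t :: real assume t: "t \<ge> 0"
      have "norm (cnj (\<phi> t) - Q t) \<le> \<bar>Re (cnj (\<phi> t) - Q t)\<bar> + \<bar>Im (cnj (\<phi> t) - Q t)\<bar>"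
        by (rule cmod_le)
      also have "\<dots> \<le> d + d"
        using q1(2)[of "exp (- t)"] q2(2)[of "exp (- t)"] t by (simp add: v_exp Q_def)
      finally show "norm (\<phi> t * (cnj (\<phi> t) - Q t)) \<le> M * (2 * d)"
        unfolding norm_mult using \<phi>M[OF t] M0 by (intro mult_mono) auto
    qed auto
    also have "\<dots> \<le> e" using M0 that by (simp add: d_def field_simps)
    finally show ?thesis .
  qed
  then have J0: "J = 0" using field_le_epsilon[of "norm J" 0] by simp
  have "((\<lambda>t. exp (- 1 * of_real t) * (\<phi> t * cnj (\<phi> t))) has_integral 0) {0..}"
    using integrable_integral[OF Ji] J0 by (simp add: J_def)
  from has_integral_linear[OF this bounded_linear_Re]
  have H: "((\<lambda>t. exp (- t) * (norm (\<phi> t))\<^sup>2) has_integral 0) {0..}"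
    unfolding o_def complex_norm_square[symmetric] by (simp add: Re_exp del: of_real_power)
  let ?h = "\<lambda>t. exp (- t) * (norm (\<phi> t))\<^sup>2"
  \<comment> \<open>The right endpoint \<open>t + 1\<close> keeps the interval nondegenerate when
    \<open>t = 0\<close>; a continuous nonnegative function with integral \<open>0\<close> on it
    vanishes at \<open>t\<close>.\<close>
  have hi: "?h integrable_on {0..t+1}"
    by (intro integrable_continuous_interval continuous_intros continuous_on_subset[OF c]) auto
  have "integral {0..t+1} ?h \<le> integral {0..} ?h"
    by (rule integral_subset_le) (use H hi in auto)
  moreover have "0 \<le> integral {0..t+1} ?h" by (rule integral_nonneg[OF hi]) auto
  ultimately have "integral {0..t+1} ?h = 0" using H by (simp add: integral_unique)
  then have "(?h has_integral 0) (cbox 0 (t+1))"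
    using hi by (simp add: has_integral_integrable_integral)
  then have "?h t = 0"
    by (rule has_integral_0_cbox_imp_0[rotated 2])
       (use t in \<open>auto intro!: continuous_intros continuous_on_subset[OF c]\<close>)
  then show ?thesis by simp
qed

text \<open>The complex measure with density \<open>f\<close> on the interval vanishes on all
  intervals. It then vanishes on Borel sets by induction over their generation, and on Lebesgue sets
  because these differ from Borel sets by null sets. Uniqueness of densities, applied to real and
  imaginary part, finishes.\<close>

lemma AE_zero_if_indefinite_integral_zero:
  fixes f :: "real \<Rightarrow> complex"
  assumes f: "f absolutely_integrable_on {0..T}" and T: "T \<ge> 0"
    and zero: "\<And>t. 0 \<le> t \<Longrightarrow> t \<le> T \<Longrightarrow> integral {0..t} f = 0"
  shows "AE t in lebesgue. t \<in> {0..T} \<longrightarrow> f t = 0"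
proof -
  define g where "g t = indicator {0..T} t *\<^sub>R f t" for t
  have g: "integrable lebesgue g" using f unfolding g_def set_integrable_def .
  have gA: "set_integrable lebesgue A g" if "A \<in> sets lebesgue" for A
    unfolding set_integrable_def using that by (intro integrable_mult_indicator g)
  have int: "set_lebesgue_integral lebesgue {a..b} g = 0" if "a \<le> b" for a b
  proof -
    have "set_lebesgue_integral lebesgue {a..b} g = set_lebesgue_integral lebesgue ({a..b} \<inter> {0..T}) f"
      unfolding set_lebesgue_integral_def g_def
      by (intro Bochner_Integration.integral_cong refl) (simp add: indicator_def)
    also have "{a..b} \<inter> {0..T} = {max a 0..min b T}" by auto
    also have "set_lebesgue_integral lebesgue {max a 0..min b T} f = integral {max a 0..min b T} f"
      by (rule set_lebesgue_integral_eq_integral(2)) (rule set_integrable_subset[OF f], auto)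
    also have "\<dots> = 0"
    proof (cases "max a 0 \<le> min b T")
      case True
      have "f integrable_on {0..min b T}"
        using set_lebesgue_integral_eq_integral(1)[OF f] by (rule integrable_on_subinterval) auto
      from Henstock_Kurzweil_Integration.integral_combine[OF _ True this]
      show ?thesis using True zero[of "max a 0"] zero[of "min b T"] by simp
    qed simp
    finally show ?thesis .
  qed
  \<comment> \<open>Needed for complements in the induction below. Cutting \<open>f\<close> off
    outside the interval is what makes the integral over the whole line available.\<close>
  have total: "set_lebesgue_integral lebesgue UNIV g = 0"
  proof -
    have "set_lebesgue_integral lebesgue UNIV g = set_lebesgue_integral lebesgue {0..T} g"
      unfolding set_lebesgue_integral_def g_def by (intro Bochner_Integration.integral_cong) (auto simp: indicator_def)
    then show ?thesis using int[OF T] by simp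
  qed
  have borel: "set_lebesgue_integral lebesgue A g = 0" if "A \<in> sets borel" for A
    using that
  proof (induction rule: borel_set_induct)
    case empty then show ?case by (simp add: set_lebesgue_integral_def)
  next
    case (interval a b) then show ?case by (rule int)
  next
    case (compl A)
    have "set_lebesgue_integral lebesgue (A \<union> - A) g =
        set_lebesgue_integral lebesgue A g + set_lebesgue_integral lebesgue (- A) g"
      by (rule set_integral_Un) (use compl in \<open>auto intro!: gA\<close>)
    then show ?case using compl total by simp
  next
    case (union A)
    have "set_lebesgue_integral lebesgue (\<Union>i. A i) g = (\<Sum>i. set_lebesgue_integral lebesgue (A i) g)"
    proof (rule lebesgue_integral_countable_add)
      show "set_integrable lebesgue (\<Union>i. A i) g" by (intro gA sets.countable_UN) (use union in auto)
    qed (use union in \<open>auto simp: disjoint_family_on_def\<close>)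
    then show ?case using union by simp
  qed
  have all: "set_lebesgue_integral lebesgue A g = 0" if A: "A \<in> sets lebesgue" for A
  proof -
    obtain S N N' where S: "A = S \<union> N" "N \<subseteq> N'" "N' \<in> null_sets lborel" "S \<in> sets lborel"
      using sets_completionE[OF A] .
    have Sl: "S \<in> sets lebesgue" using S by auto
    have "N' \<in> null_sets lebesgue" using S(3) by (simp add: null_sets_completionI)
    then have "AE x in lebesgue. x \<notin> N'" by (rule AE_not_in)
    then have ae: "AE x in lebesgue. x \<in> S \<longleftrightarrow> x \<in> A" by eventually_elim (use S in auto)
    have m: "set_borel_measurable lebesgue B g" if "B \<in> sets lebesgue" for B
      using gA[OF that] unfolding set_integrable_def set_borel_measurable_def by auto
    have "set_lebesgue_integral lebesgue A g = set_lebesgue_integral lebesgue S g"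
      by (rule set_integral_cong_set[OF m[OF Sl] m[OF A] ae])
    then show ?thesis using borel S(4) by simp
  qed
  have "AE t in lebesgue. h (g t) = 0" if h: "bounded_linear h" for h :: "complex \<Rightarrow> real"
  proof (rule density_unique_real)
    show "integrable lebesgue (\<lambda>t. h (g t))" by (rule integrable_bounded_linear[OF h g])
    fix A :: "real set" assume A: "A \<in> sets lebesgue"
    have "set_lebesgue_integral lebesgue A (\<lambda>t. h (g t)) = h (set_lebesgue_integral lebesgue A g)"
      using integral_bounded_linear[OF h gA[OF A, unfolded set_integrable_def]]
      unfolding set_lebesgue_integral_def by (simp add: linear_scale[OF bounded_linear.linear[OF h]])
    then show "set_lebesgue_integral lebesgue A (\<lambda>t. h (g t)) = set_lebesgue_integral lebesgue A (\<lambda>t. 0)"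
      using all[OF A] by (simp add: linear_0[OF bounded_linear.linear[OF h]])
  qed simp
  from this[OF bounded_linear_Re] this[OF bounded_linear_Im]
  have "AE t in lebesgue. g t = 0" by eventually_elim (simp add: complex_eq_iff)
  then show ?thesis by eventually_elim (auto simp: g_def)
qed

text \<open>Lerch's argument needs a continuous function tending to \<open>0\<close>, so it is
  applied not to \<open>f\<close> but to the truncated transform at \<open>x\<^sub>0\<close> minus
  its limit \<open>C\<close>. The constant \<open>C\<close> has the transform \<open>C / w\<close>,
  and by parts the truncated transform has the same one at every \<open>w = n + 1\<close>, so the
  moments of the difference vanish.\<close>

lemma laplace_const_imp_AE_zero:
  assumes f: "\<And>T. f absolutely_integrable_on {0..T}"
    and lim: "\<And>x. x \<ge> x\<^sub>0 \<Longrightarrow> (laplace_trunc f (of_real x) \<longlongrightarrow> C) at_top"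
  shows "AE t in lebesgue. t \<ge> 0 \<longrightarrow> f t = 0"
proof -
  let ?s = "complex_of_real x\<^sub>0"
  let ?\<Phi> = "laplace_trunc f ?s"
  have lim0: "(?\<Phi> \<longlongrightarrow> C) at_top" by (rule lim) simp
  note \<Phi>c = laplace_trunc_bounded(1)[OF f lim0]
  obtain M where M: "\<And>T. T \<ge> 0 \<Longrightarrow> norm (?\<Phi> T) \<le> M"
    using laplace_trunc_bounded(2)[OF f lim0] by blast
  have \<Phi>C: "?\<Phi> t - C = 0" if "t \<ge> 0" for t
  proof (rule lerch_continuous[where \<phi> = "\<lambda>t. ?\<Phi> t - C"])
    show "continuous_on {0..} (\<lambda>t. ?\<Phi> t - C)" by (intro continuous_intros \<Phi>c)
    show "((\<lambda>t. ?\<Phi> t - C) \<longlongrightarrow> 0) at_top" using lim0 by (simp add: LIM_zero)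
    fix n :: nat
    let ?w = "complex_of_nat (Suc n)"
    let ?K = "integral {0..} (\<lambda>t. exp (- ?w * of_real t) * ?\<Phi> t)"
    have "(laplace_trunc f (?s + ?w) \<longlongrightarrow> ?w * ?K) at_top"
      using laplace_half_plane[OF f lim0, of "?s + ?w"] by simp
    moreover have "(laplace_trunc f (?s + ?w) \<longlongrightarrow> C) at_top"
      using lim[of "x\<^sub>0 + real (Suc n)"] by simp
    ultimately have K: "?w * ?K = C" using tendsto_unique[OF trivial_limit_at_top_linorder] by blast
    have Ki: "(\<lambda>t. exp (- ?w * of_real t) * ?\<Phi> t) integrable_on {0..}"
      by (rule laplace_tail(1)[OF \<Phi>c M]) auto
    have "((\<lambda>t. exp (- real (Suc n) * t)) has_integral (exp (- real (Suc n) * 0) / real (Suc n))) {0..}"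
      by (rule has_integral_exp_minus_to_infinity) simp
    from has_integral_linear[OF this bounded_linear_of_real[where ?'a = complex]]
    have E: "((\<lambda>t. exp (- ?w * of_real t)) has_integral (1 / ?w)) {0..}"
      by (simp add: o_def exp_of_real[symmetric])
    have "((\<lambda>t. exp (- ?w * of_real t) * ?\<Phi> t - exp (- ?w * of_real t) * C) has_integral ?K - 1 / ?w * C) {0..}"
      by (intro has_integral_diff integrable_integral Ki has_integral_mult_left E)
    moreover have "?K - 1 / ?w * C = 0"
      unfolding K[symmetric] by (simp add: divide_simps del: of_nat_Suc)
    ultimately show "integral {0..} (\<lambda>t. exp (- ?w * of_real t) * (?\<Phi> t - C)) = 0"
      by (simp add: right_diff_distrib integral_unique)
  qed (use that in simp)
  \<comment> \<open>An integral over a single point is \<open>0\<close>; evaluating the identity at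
    \<open>0\<close> is what excludes a nonzero constant.\<close>
  have "?\<Phi> 0 = 0" by (simp add: laplace_trunc_def)
  then have "C = 0" using \<Phi>C[of 0] by simp
  then have zero: "integral {0..t} (\<lambda>t. exp (- ?s * of_real t) * f t) = 0" if "t \<ge> 0" for t
    using \<Phi>C[OF that] by (simp add: laplace_trunc_def)
  have "AE t in lebesgue. t \<in> {0..real n} \<longrightarrow> exp (- ?s * of_real t) * f t = 0" for n
    by (rule AE_zero_if_indefinite_integral_zero) (use zero exp_mult_absolutely_integrable[OF f] in auto)
  then have "AE t in lebesgue. \<forall>n. t \<in> {0..real n} \<longrightarrow> exp (- ?s * of_real t) * f t = 0"
    unfolding AE_all_countable by blast
  then show ?thesis
    by eventually_elim (metis atLeastAtMost_iff exp_not_eq_zero mult_eq_0_iff real_arch_simple)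
qed

section \<open>Entire functions with a Phragmen-Lindelof condition\<close>

text \<open>The damping factor is \<open>exp (- \<delta> * cos (k * w))\<close> with
  \<open>K < k < pi / (2 * e)\<close>. The upper bound on \<open>k\<close> keeps
  \<open>cos (k * Re w)\<close> above \<open>c0 > 0\<close> in the strip, so that
  \<open>Re (cos (k * w)) = cos (k * Re w) * cosh (k * Im w)\<close> grows like
  \<open>exp (k * \<bar>Im w\<bar>)\<close>.\<close>

lemma phragmen_lindelof_strip_bound:
  fixes H :: "complex \<Rightarrow> complex"
  assumes H: "continuous_on {z. \<bar>Re z\<bar> \<le> e} H" "H holomorphic_on {z. \<bar>Re z\<bar> < e}"
    and e: "e > 0" and C: "C > 0"
    and bd: "\<And>z. \<bar>Re z\<bar> = e \<Longrightarrow> norm (H z) \<le> C"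
    and growth: "\<And>z. \<bar>Re z\<bar> \<le> e \<Longrightarrow> norm (H z) \<le> A * exp (B * exp (K * \<bar>Im z\<bar>))"
    and K: "0 \<le> K" "K * e < pi / 2"
    and z: "\<bar>Re z\<bar> \<le> e"
  shows "norm (H z) \<le> C"
proof -
  obtain k where k: "K < k" "k < pi / (2 * e)"
    using dense[of K "pi / (2 * e)"] K e by (auto simp: field_simps)
  have ke: "k * e < pi / 2" using k e by (simp add: field_simps)
  have k0: "k > 0" using k K by simp
  define c0 where "c0 = cos (k * e)"
  have c0: "c0 > 0" unfolding c0_def using ke k0 e by (intro cos_gt_zero_pi) (auto intro: less_trans[of _ 0])
  have Re_cos_ge: "Re (cos (of_real k * w)) \<ge> c0 / 2 * exp (k * \<bar>Im w\<bar>)" if w: "\<bar>Re w\<bar> \<le> e" for w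
  proof -
    have "c0 \<le> cos (k * \<bar>Re w\<bar>)"
      unfolding c0_def using w k0 ke mult_pos_pos[OF k0 e] by (intro cos_monotone_0_pi_le) (auto simp: mult_left_mono)
    also have "\<dots> = cos (k * Re w)" by (simp add: abs_if)
    finally have 1: "c0 \<le> cos (k * Re w)" .
    have 2: "exp (k * \<bar>Im w\<bar>) \<le> exp (k * Im w) + exp (- (k * Im w))" by (simp add: abs_if)
    have "c0 * exp (k * \<bar>Im w\<bar>) \<le> cos (k * Re w) * (exp (k * Im w) + exp (- (k * Im w)))"
      using 1 2 c0 by (intro mult_mono) auto
    then show ?thesis by (simp add: Re_cos)
  qed
  have main: "norm (H z) \<le> C * exp (\<delta> * Re (cos (of_real k * z)))" if \<delta>: "\<delta> > 0" for \<delta> :: real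
  proof -
    \<comment> \<open>As \<open>K < k\<close>, the factor beats the growth of \<open>H\<close> vertically, and it tends to \<open>1\<close> as \<open>\<delta> \<rightarrow> 0\<close>.\<close>
    define g where "g w = H w * exp (- of_real \<delta> * cos (of_real k * w))" for w
    have norm_g: "norm (g w) = norm (H w) * exp (- \<delta> * Re (cos (of_real k * w)))" for w
      by (simp add: g_def norm_mult)
    have g_le: "norm (g w) \<le> norm (H w)" if "\<bar>Re w\<bar> \<le> e" for w
    proof -
      have "0 \<le> c0 / 2 * exp (k * \<bar>Im w\<bar>)" using c0 by simp
      also have "\<dots> \<le> Re (cos (of_real k * w))" by (rule Re_cos_ge[OF that])
      finally show ?thesis unfolding norm_g using \<delta> by (simp add: mult_left_le)
    qed
    \<comment> \<open>The height \<open>R\<close> is chosen so that the damping beats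
      \<open>B\<close> with a margin of \<open>ln (\<bar>A\<bar> / C)\<close>, which brings the
      horizontal edges below \<open>C\<close>. The maximum with \<open>0\<close> allows the factor
      \<open>exp (K * R) \<ge> 1\<close> to be dropped, and \<open>R > \<bar>Im z\<bar>\<close> puts
      \<open>z\<close> inside the rectangle.\<close>
    have "filterlim (\<lambda>y. \<delta> * c0 / 2 * exp ((k - K) * y)) at_top at_top"
      using \<delta> c0 k by real_asymp
    then have "\<forall>\<^sub>F y in at_top. \<delta> * c0 / 2 * exp ((k - K) * y) \<ge> B + max 0 (ln (\<bar>A\<bar> / C))"
      unfolding filterlim_at_top by blast
    then have "\<forall>\<^sub>F y in at_top. \<delta> * c0 / 2 * exp ((k - K) * y) \<ge> B + max 0 (ln (\<bar>A\<bar> / C)) \<and> y \<ge> \<bar>Im z\<bar> + 1"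
      by (intro eventually_conj eventually_ge_at_top)
    then obtain R where R: "\<delta> * c0 / 2 * exp ((k - K) * R) \<ge> B + max 0 (ln (\<bar>A\<bar> / C))" "R \<ge> \<bar>Im z\<bar> + 1"
      by (auto simp: eventually_at_top_linorder)
    have far: "norm (g w) \<le> C" if w: "\<bar>Re w\<bar> \<le> e" "\<bar>Im w\<bar> = R" for w
    proof -
      have "norm (H w) \<le> \<bar>A\<bar> * exp (B * exp (K * R))"
        using growth[OF w(1)] w(2) abs_ge_self[of A]
        by (metis exp_ge_zero mult_right_mono order.trans)
      moreover have "exp (- \<delta> * Re (cos (of_real k * w))) \<le> exp (- \<delta> * (c0 / 2 * exp (k * R)))"
        using Re_cos_ge[OF w(1)] w(2) \<delta> by simp
      ultimately have "norm (g w) \<le> (\<bar>A\<bar> * exp (B * exp (K * R))) * exp (- \<delta> * (c0 / 2 * exp (k * R)))"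
        unfolding norm_g by (intro mult_mono) auto
      also have "\<dots> = \<bar>A\<bar> * exp (B * exp (K * R) - \<delta> * (c0 / 2 * exp (k * R)))"
        by (simp add: mult_exp_exp)
      also have "exp (k * R) = exp (K * R) * exp ((k - K) * R)"
        by (simp add: mult_exp_exp algebra_simps)
      also have "B * exp (K * R) - \<delta> * (c0 / 2 * (exp (K * R) * exp ((k - K) * R)))
          = - (exp (K * R) * (\<delta> * c0 / 2 * exp ((k - K) * R) - B))" by (simp add: algebra_simps)
      also have "\<bar>A\<bar> * exp (- (exp (K * R) * (\<delta> * c0 / 2 * exp ((k - K) * R) - B))) \<le> C"
      proof (cases "A = 0")
        case False
        have "1 * max 0 (ln (\<bar>A\<bar> / C)) \<le> exp (K * R) * (\<delta> * c0 / 2 * exp ((k - K) * R) - B)"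
          using R K(1) by (intro mult_mono) auto
        then have "- (exp (K * R) * (\<delta> * c0 / 2 * exp ((k - K) * R) - B)) \<le> - ln (\<bar>A\<bar> / C)" by simp
        then have "exp (- (exp (K * R) * (\<delta> * c0 / 2 * exp ((k - K) * R) - B))) \<le> exp (- ln (\<bar>A\<bar> / C))" by simp
        also have "\<dots> = C / \<bar>A\<bar>" using False C by (simp add: exp_minus)
        finally show ?thesis using False by (simp add: field_simps)
      qed (use C in simp)
      finally show ?thesis .
    qed
    let ?S = "cbox (Complex (- e) (- R)) (Complex e R)"
    have sub: "?S \<subseteq> {z. \<bar>Re z\<bar> \<le> e}" by (auto simp: in_cbox_complex_iff)
    have isub: "interior ?S \<subseteq> {z. \<bar>Re z\<bar> < e}" by (auto simp: in_box_complex_iff)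
    have "norm (g z) \<le> C"
    proof (rule maximum_modulus_frontier[of g ?S])
      show "g holomorphic_on interior ?S" unfolding g_def
        by (intro holomorphic_intros holomorphic_on_subset[OF H(2) isub])
      show "continuous_on (closure ?S) g" unfolding g_def
        by (intro continuous_intros continuous_on_subset[OF H(1)]) (use sub in auto)
      show "z \<in> ?S" using z R by (auto simp: in_cbox_complex_iff)
      fix w assume "w \<in> frontier ?S"
      then have "w \<in> ?S" "w \<notin> box (Complex (- e) (- R)) (Complex e R)"
        by (auto simp: frontier_def)
      then have "\<bar>Re w\<bar> \<le> e" "\<bar>Re w\<bar> = e \<or> \<bar>Im w\<bar> = R"
        by (auto simp: in_cbox_complex_iff in_box_complex_iff)
      then show "norm (g w) \<le> C" using far bd g_le order.trans by blast
    qed simp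
    then have "norm (H z) * exp (- \<delta> * Re (cos (of_real k * z))) \<le> C" by (simp only: norm_g)
    then show ?thesis by (simp add: exp_minus field_simps)
  qed
  have "((\<lambda>\<delta>. C * exp (\<delta> * Re (cos (of_real k * z)))) \<longlongrightarrow> C * exp (0 * Re (cos (of_real k * z)))) (at_right 0)"
    by (intro tendsto_intros)
  then show ?thesis
    by (rule tendsto_lowerbound[OF tendsto_eq_rhs])
       (use main in \<open>auto simp: eventually_at_filter\<close>)
qed

text \<open>Dividing by \<open>w + 2\<close> reduces linear growth on the edges to boundedness
  there. Since \<open>e < 1\<close>, the divisor has norm at least \<open>1\<close> in the strip,
  and there \<open>1 + norm w \<le> 3 + norm (w + 2) \<le> 4 * norm (w + 2)\<close>.\<close>

lemma entire_linear_growth: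
  fixes G :: "complex \<Rightarrow> complex"
  assumes G: "G holomorphic_on UNIV" and e: "0 < e" "e < 1" and C: "C > 0"
    and out: "\<And>z. \<bar>Re z\<bar> \<ge> e \<Longrightarrow> norm (G z) \<le> C * (1 + norm z)"
    and growth: "\<And>z. \<bar>Re z\<bar> < e \<Longrightarrow> \<bar>Im z\<bar> \<ge> Y \<Longrightarrow> norm (G z) \<le> A * exp (B * exp (K * \<bar>Im z\<bar>))"
    and AB: "A \<ge> 0" "B \<ge> 0" and K: "0 \<le> K" "K * e < pi / 2"
  shows "norm (G z) \<le> 8 * C * (1 + norm z)"
proof (cases "\<bar>Re z\<bar> \<le> e")
  case True
  have ge1: "norm (w + 2) \<ge> 1" if "\<bar>Re w\<bar> \<le> e" for w :: complex
    using complex_Re_le_cmod[of "w + 2"] that e by simp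
  have ge2: "1 + norm w \<le> 4 * norm (w + 2)" if "\<bar>Re w\<bar> \<le> e" for w :: complex
    using ge1[OF that] norm_triangle_ineq4[of "w + 2" 2] by simp
  define H where "H w = G w / (w + 2)" for w
  have nz: "w + 2 \<noteq> 0" if "\<bar>Re w\<bar> \<le> e" for w :: complex using ge1[OF that] by auto
  have Gc: "continuous_on S G" for S
    using holomorphic_on_imp_continuous_on[OF G] continuous_on_subset by blast
  have HG: "norm (H w) \<le> norm (G w)" if "\<bar>Re w\<bar> \<le> e" for w
    using ge1[OF that] mult_left_mono[OF ge1[OF that] norm_ge_zero[of "G w"]]
    unfolding H_def norm_divide by (simp add: divide_le_eq)
  have Hb: "norm (H w) \<le> 4 * C" if "\<bar>Re w\<bar> = e" for w
  proof -
    have "norm (G w) \<le> C * (1 + norm w)" using out that by simp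
    also have "\<dots> \<le> C * (4 * norm (w + 2))" using C ge2[of w] that by (intro mult_left_mono) auto
    finally show ?thesis unfolding H_def norm_divide using ge1[of w] that
      by (subst pos_divide_le_eq) auto
  qed
  \<comment> \<open>The growth hypothesis says nothing below height \<open>Y\<close>; compactness
    covers that part. The absolute value keeps the rectangle nonempty for every
    \<open>Y\<close>.\<close>
  have "bounded (G ` cbox (Complex (- e) (- \<bar>Y\<bar>)) (Complex e \<bar>Y\<bar>))"
    by (intro compact_imp_bounded compact_continuous_image Gc) auto
  then obtain M where M: "\<And>w. w \<in> cbox (Complex (- e) (- \<bar>Y\<bar>)) (Complex e \<bar>Y\<bar>) \<Longrightarrow> norm (G w) \<le> M"
    unfolding bounded_iff by blast
  have "0 \<in> cbox (Complex (- e) (- \<bar>Y\<bar>)) (Complex e \<bar>Y\<bar>)" using e by (simp add: in_cbox_complex_iff)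
  then have M0: "M \<ge> 0" using M norm_ge_zero order.trans by blast
  \<comment> \<open>The constant \<open>A + M + 4 * C\<close> dominates the three cases: the high
    part of the strip, the compact part, and the edges.\<close>
  have "norm (H z) \<le> 4 * C"
  proof (rule phragmen_lindelof_strip_bound[where H = H and z = z and e = e and A = "A + M + 4 * C" and B = B and K = K])
    show "continuous_on {z. \<bar>Re z\<bar> \<le> e} H" unfolding H_def
      by (intro continuous_intros Gc) (use nz in auto)
    show "H holomorphic_on {z. \<bar>Re z\<bar> < e}" unfolding H_def
      by (intro holomorphic_intros holomorphic_on_subset[OF G]) (use nz in auto)
    fix w :: complex assume w: "\<bar>Re w\<bar> \<le> e"
    define E where "E = exp (B * exp (K * \<bar>Im w\<bar>))"
    have E: "E \<ge> 1" using AB by (simp add: E_def)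
    have "norm (H w) \<le> A * E \<or> norm (H w) \<le> M \<or> norm (H w) \<le> 4 * C"
    proof (cases "\<bar>Re w\<bar> = e")
      case False
      then have lt: "\<bar>Re w\<bar> < e" using w by simp
      show ?thesis
      proof (cases "\<bar>Im w\<bar> \<ge> Y")
        case True then show ?thesis using growth[OF lt] HG[OF w] unfolding E_def by linarith
      next
        case False
        then have "w \<in> cbox (Complex (- e) (- \<bar>Y\<bar>)) (Complex e \<bar>Y\<bar>)"
          using w by (auto simp: in_cbox_complex_iff)
        then show ?thesis using M HG[OF w] by fastforce
      qed
    qed (use Hb in simp)
    moreover have "A * E \<le> (A + M + 4 * C) * E" "M \<le> M * E" "4 * C \<le> 4 * C * E"
      "M * E \<le> (A + M + 4 * C) * E" "4 * C * E \<le> (A + M + 4 * C) * E"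
      using E M0 AB C by (auto intro!: mult_right_mono simp: mult_le_cancel_left1)
    ultimately have "norm (H w) \<le> (A + M + 4 * C) * E" by linarith
    then show "norm (H w) \<le> (A + M + 4 * C) * exp (B * exp (K * \<bar>Im w\<bar>))" by (simp add: E_def)
  qed (use e C K Hb True in auto)
  then have "norm (G z) \<le> 4 * C * norm (z + 2)"
    unfolding H_def norm_divide using ge1[OF True] by (subst (asm) pos_divide_le_eq) auto
  also have "\<dots> \<le> 4 * C * (norm z + 2)"
    using C norm_triangle_ineq[of z 2] by (intro mult_left_mono) auto
  also have "\<dots> \<le> 8 * C * (1 + norm z)" using C by (simp add: algebra_simps)
  finally show ?thesis .
next
  case False
  then have "norm (G z) \<le> C * (1 + norm z)" using out by simp
  also have "\<dots> \<le> 8 * C * (1 + norm z)" using C by (intro mult_right_mono) auto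
  finally show ?thesis .
qed

lemma entire_linear_growth_const:
  fixes G :: "complex \<Rightarrow> complex"
  assumes G: "G holomorphic_on UNIV" and lin: "\<And>z. norm (G z) \<le> C * (1 + norm z)"
    and bd: "\<And>x. x \<ge> x\<^sub>0 \<Longrightarrow> norm (G (of_real x)) \<le> M"
  shows "G z = G 0"
proof -
  have eq: "G z = (\<Sum>k\<le>1. (deriv ^^ k) G 0 / fact k * z ^ k)" for z
  proof (rule Liouville_polynomial[OF G])
    fix z :: complex assume z: "1 \<le> norm z"
    have C0: "C \<ge> 0" using order.trans[OF norm_ge_zero lin[of 0]] by simp
    have "norm (G z) \<le> C * (1 + norm z)" by (rule lin)
    also have "\<dots> \<le> C * (2 * norm z)" using z C0 by (intro mult_left_mono) auto
    finally show "norm (G z) \<le> (2 * C) * norm z ^ 1" by (simp add: algebra_simps)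
  qed
  define b where "b = deriv G 0"
  have G_eq: "G z = G 0 + b * z" for z using eq[of z] by (simp add: b_def)
  have "b = 0"
  proof (rule ccontr)
    assume b: "b \<noteq> 0"
    \<comment> \<open>The last entry makes \<open>norm b * x\<close> exceed
      \<open>M + norm (G 0)\<close>, contradicting the bound on the ray; the other two put
      \<open>x\<close> on the ray and make it nonnegative.\<close>
    define x where "x = max (max x\<^sub>0 0) ((M + norm (G 0) + 1) / norm b)"
    have x_ge: "x \<ge> x\<^sub>0" by (simp add: x_def)
    have "norm b * x = norm (G (of_real x) - G 0)"
      unfolding G_eq[of "of_real x"] by (simp add: norm_mult x_def)
    also have "\<dots> \<le> M + norm (G 0)"
      using norm_triangle_ineq4[of "G (of_real x)" "G 0"] bd[OF x_ge] by linarith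
    also have "\<dots> < norm b * ((M + norm (G 0) + 1) / norm b)" using b by simp
    also have "\<dots> \<le> norm b * x" by (intro mult_left_mono) (auto simp: x_def)
    finally show False by simp
  qed
  then show ?thesis using G_eq[of z] by simp
qed

section \<open>Bilateral transforms and principal parts\<close>

lemma locally_integrable_reflect:
  "locally_integrable f \<Longrightarrow> locally_integrable (\<lambda>t. f (- t))"
  unfolding locally_integrable_def
  by (metis absolutely_integrable_reflect_real minus_minus)

text \<open>This is where the independence of the two endpoints enters: with \<open>x\<close> fixed,
  two values of \<open>y\<close> can be compared, so \<open>v\<close> is Cauchy. Once
  \<open>v\<close> converges, so does \<open>u\<close>.\<close>

lemma tendsto_of_sum_tendsto:
  fixes u v :: "real \<Rightarrow> complex"
  assumes "((\<lambda>(x, y). u x + v y) \<longlongrightarrow> L) (F \<times>\<^sub>F G)" and "F \<noteq> bot" "G \<noteq> bot"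
  obtains c where "(v \<longlongrightarrow> c) G" and "(u \<longlongrightarrow> L - c) F"
proof -
  have ev: "\<exists>P Q. eventually P F \<and> eventually Q G \<and> (\<forall>x y. P x \<longrightarrow> Q y \<longrightarrow> dist (u x + v y) L < e)"
    if "e > 0" for e
    using tendstoD[OF assms(1) that] by (simp add: eventually_prod_filter)
  have "cauchy_filter (filtermap v G)"
    unfolding cauchy_filter_metric_filtermap
  proof (intro allI impI)
    fix e :: real assume "e > 0"
    then obtain P Q where P: "eventually P F" and Q: "eventually Q G"
      and d: "\<And>x y. P x \<Longrightarrow> Q y \<Longrightarrow> dist (u x + v y) L < e / 2"
      using ev[of "e / 2"] by auto
    obtain x where "P x" using eventually_happens'[OF assms(2) P] by blast
    then have "dist (v y) (v z) < e" if "Q y" "Q z" for y z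
      using dist_triangle_half_l[OF d[of x y] d[of x z]] that by simp
    then show "\<exists>P. eventually P G \<and> (\<forall>x y. P x \<and> P y \<longrightarrow> dist (v x) (v y) < e)"
      using Q by blast
  qed
  moreover have "complete (UNIV :: complex set)" by (rule complete_UNIV)
  ultimately obtain c where c: "(v \<longlongrightarrow> c) G"
    using cauchy_filter_complete_converges[of "filtermap v G" UNIV] assms(3)
    by (auto simp: filterlim_def filtermap_bot_iff)
  have "(u \<longlongrightarrow> L - c) F"
  proof (rule tendstoI)
    fix e :: real assume e: "e > 0"
    obtain P Q where P: "eventually P F" and Q: "eventually Q G"
      and d: "\<And>x y. P x \<Longrightarrow> Q y \<Longrightarrow> dist (u x + v y) L < e / 2"
      using ev[of "e / 2"] e by auto
    have "\<forall>\<^sub>F y in G. Q y \<and> dist (v y) c < e / 2"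
      using Q tendstoD[OF c, of "e / 2"] e by (auto intro: eventually_conj)
    then obtain y where y: "Q y" "dist (v y) c < e / 2" using eventually_happens'[OF assms(3)] by blast
    show "\<forall>\<^sub>F x in F. dist (u x) (L - c) < e"
      using P
    proof eventually_elim
      case (elim x)
      have "dist (u x) (L - c) = norm ((u x + v y - L) - (v y - c))" by (simp add: dist_norm algebra_simps)
      also have "\<dots> \<le> dist (u x + v y) L + dist (v y) c" unfolding dist_norm by (rule norm_triangle_ineq4)
      finally show ?case using d[OF elim y(1)] y(2) by simp
    qed
  qed
  with c show ?thesis by (rule that)
qed

text \<open>The part over the negative half line becomes, under \<open>t \<mapsto> - t\<close>, a
  transform over the positive one, at \<open>- s\<close> and with the reflected function. The
  half-line theory thus covers both sides.\<close>

lemma has_bilateral_laplace_split: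
  assumes f: "locally_integrable f" and L: "has_bilateral_laplace f s L"
  obtains L1 L2 where "(laplace_trunc f s \<longlongrightarrow> L1) at_top"
    and "(laplace_trunc (\<lambda>t. f (- t)) (- s) \<longlongrightarrow> L2) at_top" and "L = L1 + L2"
proof -
  have fi: "f absolutely_integrable_on {x..y}" for x y using f by (simp add: locally_integrable_def)
  note gi = exp_mult_absolutely_integrable[OF fi, where s = s]
  have eq: "(LINT t:{A..B}|lebesgue. exp (- s * of_real t) * f t) =
      laplace_trunc (\<lambda>t. f (- t)) (- s) (- A) + laplace_trunc f s B" if "A \<le> 0" "0 \<le> B" for A B
  proof -
    have "(LINT t:{A..B}|lebesgue. exp (- s * of_real t) * f t) = integral {A..B} (\<lambda>t. exp (- s * of_real t) * f t)"
      by (rule set_lebesgue_integral_eq_integral(2)[OF gi])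
    also have "\<dots> = integral {A..0} (\<lambda>t. exp (- s * of_real t) * f t) + laplace_trunc f s B"
      unfolding laplace_trunc_def
      by (rule Henstock_Kurzweil_Integration.integral_combine[symmetric])
         (use that set_lebesgue_integral_eq_integral(1)[OF gi] in auto)
    also have "integral {A..0} (\<lambda>t. exp (- s * of_real t) * f t) = laplace_trunc (\<lambda>t. f (- t)) (- s) (- A)"
      unfolding laplace_trunc_def
      using Henstock_Kurzweil_Integration.integral_reflect_real[of 0 A "\<lambda>t. exp (- s * of_real t) * f t"] by simp
    finally show ?thesis .
  qed
  have "((\<lambda>(A, B). laplace_trunc (\<lambda>t. f (- t)) (- s) (- A) + laplace_trunc f s B) \<longlongrightarrow> L) (at_bot \<times>\<^sub>F at_top)"
  proof (rule Lim_transform_eventually[OF L[unfolded has_bilateral_laplace_def]])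
    show "\<forall>\<^sub>F p in at_bot \<times>\<^sub>F at_top. (case p of (A, B) \<Rightarrow> LINT t:{A..B}|lebesgue. exp (- s * of_real t) * f t) =
      (case p of (A, B) \<Rightarrow> laplace_trunc (\<lambda>t. f (- t)) (- s) (- A) + laplace_trunc f s B)"
      unfolding eventually_prod_filter
      by (rule exI[of _ "\<lambda>A. A \<le> 0"], rule exI[of _ "\<lambda>B. 0 \<le> B"])
         (use eq in \<open>simp add: eventually_le_at_bot eventually_ge_at_top\<close>)
  qed
  then obtain c where c: "(laplace_trunc f s \<longlongrightarrow> c) at_top"
    and d: "((\<lambda>A. laplace_trunc (\<lambda>t. f (- t)) (- s) (- A)) \<longlongrightarrow> L - c) at_bot"
    by (rule tendsto_of_sum_tendsto[where u = "\<lambda>A. laplace_trunc (\<lambda>t. f (- t)) (- s) (- A)"]) auto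
  have "(laplace_trunc (\<lambda>t. f (- t)) (- s) \<longlongrightarrow> L - c) at_top"
    using filterlim_compose[OF d filterlim_uminus_at_bot_at_top] by simp
  with c show ?thesis by (rule that) simp
qed

lemma laplace_trunc_diff:
  assumes "\<And>T. f absolutely_integrable_on {0..T}" "\<And>T. g absolutely_integrable_on {0..T}"
  shows "laplace_trunc (\<lambda>t. f t - g t) s = (\<lambda>T. laplace_trunc f s T - laplace_trunc g s T)"
proof
  fix T
  show "laplace_trunc (\<lambda>t. f t - g t) s T = laplace_trunc f s T - laplace_trunc g s T"
    unfolding laplace_trunc_def right_diff_distrib
    by (rule Henstock_Kurzweil_Integration.integral_diff;
        rule set_lebesgue_integral_eq_integral(1)[OF exp_mult_absolutely_integrable]) (use assms in auto)
qed

text \<open>Induction by integration by parts: the derivative of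
  \<open>exp (- w * t) * t ^ Suc k / fact (Suc k)\<close> links the integrals for \<open>k\<close>
  and \<open>Suc k\<close>, each step costing a factor \<open>1 / w\<close> and a boundary term that
  tends to \<open>0\<close>.\<close>

lemma monomial_laplace_tendsto:
  assumes w: "Re w > 0"
  shows "((\<lambda>T. integral {0..T} (\<lambda>t. exp (- w * of_real t) * (of_real t ^ k / fact k))) \<longlongrightarrow> 1 / w ^ Suc k) at_top"
proof (induction k)
  case 0
  have w0: "w \<noteq> 0" using w by auto
  have "((\<lambda>T. (1 - exp (- w * of_real T)) / w) \<longlongrightarrow> (1 - 0) / w) at_top"
  proof (intro tendsto_intros w0)
    have "((\<lambda>T. exp (- Re w * T)) \<longlongrightarrow> 0) at_top" using w by real_asymp
    then show "((\<lambda>T. exp (- w * of_real T)) \<longlongrightarrow> 0) at_top"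
      by (subst tendsto_norm_zero_iff[symmetric]) simp
  qed
  moreover have "\<forall>\<^sub>F T in at_top. (1 - exp (- w * of_real T)) / w =
      integral {0..T} (\<lambda>t. exp (- w * of_real t) * (of_real t ^ 0 / fact 0))"
    using eventually_ge_at_top[of 0]
  proof eventually_elim
    case (elim T)
    have "((\<lambda>t. exp (- w * of_real t)) has_integral
       (- exp (- w * of_real T) / w - (- exp (- w * of_real 0) / w))) {0..T}"
    proof (rule fundamental_theorem_of_calculus[OF elim])
      show "((\<lambda>t. - exp (- w * of_real t) / w) has_vector_derivative exp (- w * of_real t)) (at t within {0..T})" for t
        by (rule has_vector_derivative_eq_rhs, rule has_vector_derivative_real_field)
           (auto intro!: derivative_eq_intros simp: w0)
    qed
    then show ?case by (simp add: integral_unique diff_divide_distrib)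
  qed
  ultimately show ?case using Lim_transform_eventually by fastforce
next
  case (Suc k)
  have w0: "w \<noteq> 0" using w by auto
  let ?I = "\<lambda>k T. integral {0..T} (\<lambda>t. exp (- w * of_real t) * (of_real t ^ k / fact k))"
  let ?b = "\<lambda>T. exp (- w * of_real T) * (of_real T ^ Suc k / fact (Suc k))"
  have b: "(?b \<longlongrightarrow> 0) at_top"
  proof (rule Lim_null_comparison)
    have "((\<lambda>T. exp (- Re w * T) * (T ^ Suc k / fact (Suc k))) \<longlongrightarrow> 0) at_top"
      using w by real_asymp
    then show "((\<lambda>T. exp (- Re w * T) * (\<bar>T\<bar> ^ Suc k / fact (Suc k))) \<longlongrightarrow> 0) at_top"
      by (rule Lim_transform_eventually)
         (auto intro: eventually_mono[OF eventually_ge_at_top[of 0]])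
  qed (simp add: norm_mult norm_divide norm_power norm_fact del: fact_Suc power_Suc)
  have "((\<lambda>T. (?I k T - ?b T) / w) \<longlongrightarrow> (1 / w ^ Suc k - 0) / w) at_top"
    by (intro tendsto_intros Suc.IH b w0)
  moreover have "\<forall>\<^sub>F T in at_top. (?I k T - ?b T) / w = ?I (Suc k) T"
    using eventually_ge_at_top[of 0]
  proof eventually_elim
    case (elim T)
    have ii: "(\<lambda>t. exp (- w * of_real t) * (of_real t ^ j / fact j)) integrable_on {0..T}" for j
      by (intro integrable_continuous_interval continuous_intros) auto
    have "((\<lambda>t. exp (- w * of_real t) * (of_real t ^ k / fact k) -
        w * (exp (- w * of_real t) * (of_real t ^ Suc k / fact (Suc k)))) has_integral
        ?b T - ?b 0) {0..T}"
    proof (rule fundamental_theorem_of_calculus[OF elim])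
      fix t :: real
      have "((\<lambda>z. exp (- w * z) * (z ^ Suc k / fact (Suc k))) has_field_derivative
          exp (- w * z) * (z ^ k / fact k) - w * (exp (- w * z) * (z ^ Suc k / fact (Suc k)))) (at z)" for z :: complex
      proof -
        have "((\<lambda>z. z ^ Suc k / fact (Suc k)) has_field_derivative of_nat (Suc k) * z ^ k / fact (Suc k)) (at z)"
          using DERIV_cdivide[OF DERIV_power[OF DERIV_ident, of "Suc k" z UNIV], of "fact (Suc k)"] by (simp del: fact_Suc)
        also have "of_nat (Suc k) * z ^ k / fact (Suc k) = z ^ k / fact k"
          unfolding fact_Suc by (simp del: of_nat_Suc)
        finally have 1: "((\<lambda>z. z ^ Suc k / fact (Suc k)) has_field_derivative z ^ k / fact k) (at z)" .
        have 2: "((\<lambda>z. exp (- w * z)) has_field_derivative - w * exp (- w * z)) (at z)"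
          by (auto intro!: derivative_eq_intros)
        show ?thesis
          by (rule DERIV_cong[OF DERIV_mult[OF 2 1]]) (simp add: algebra_simps del: fact_Suc power_Suc)
      qed
      then show "(?b has_vector_derivative exp (- w * of_real t) * (of_real t ^ k / fact k) -
        w * (exp (- w * of_real t) * (of_real t ^ Suc k / fact (Suc k)))) (at t within {0..T})"
        by (rule has_vector_derivative_real_field)
    qed
    moreover have "((\<lambda>t. exp (- w * of_real t) * (of_real t ^ k / fact k) -
        w * (exp (- w * of_real t) * (of_real t ^ Suc k / fact (Suc k)))) has_integral
        ?I k T - w * ?I (Suc k) T) {0..T}"
      by (intro has_integral_diff has_integral_mult_right integrable_integral ii)
    ultimately have "?b T - ?b 0 = ?I k T - w * ?I (Suc k) T" by (rule has_integral_unique)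
    then show ?case using w0 by (simp add: field_simps)
  qed
  ultimately have "(?I (Suc k) \<longlongrightarrow> (1 / w ^ Suc k - 0) / w) at_top"
    by (rule Lim_transform_eventually)
  then show ?case by (simp add: mult.commute)
qed

text \<open>Frequencies and coefficients are parameters because reflection in \<open>t\<close>
  changes both; the negative half line uses another instance.\<close>

definition exp_poly :: "nat \<Rightarrow> (nat \<Rightarrow> real) \<Rightarrow> (nat \<Rightarrow> nat) \<Rightarrow> (nat \<Rightarrow> nat \<Rightarrow> complex) \<Rightarrow> real \<Rightarrow> complex" where
  "exp_poly N p r c t = (\<Sum>n=1..N. exp (\<i> * complex_of_real (p n) * complex_of_real t) *
               (\<Sum>k=1..r n. c n k * complex_of_real t ^ (k - 1) / fact (k - 1)))"

definition principal_parts :: "nat \<Rightarrow> (nat \<Rightarrow> real) \<Rightarrow> (nat \<Rightarrow> nat) \<Rightarrow> (nat \<Rightarrow> nat \<Rightarrow> complex) \<Rightarrow> complex \<Rightarrow> complex" where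
  "principal_parts N p r c s = (\<Sum>n=1..N. \<Sum>k=1..r n. c n k / (s - \<i> * complex_of_real (p n)) ^ k)"

lemma exp_poly_reflect:
  "exp_poly N p r c (- t) = exp_poly N (\<lambda>n. - p n) r (\<lambda>n k. c n k * (- 1) ^ (k - 1)) t"
  unfolding exp_poly_def
  by (intro sum.cong refl arg_cong2[where f = "(*)"]) (simp_all add: power_minus[of "of_real t"] mult_ac)

text \<open>The outer minus sign arises because the coefficients carry
  \<open>(- 1) ^ (k - 1)\<close> while the denominators contribute \<open>(- 1) ^ k\<close>. It
  matches the sign of the left-hand formula for \<open>G\<close> in the final theorem.\<close>

lemma principal_parts_reflect:
  "principal_parts N (\<lambda>n. - p n) r (\<lambda>n k. c n k * (- 1) ^ (k - 1)) s = - principal_parts N p r c (- s)"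
proof -
  have "c n k * (- 1) ^ (k - 1) / (s - \<i> * complex_of_real (- p n)) ^ k =
      - (c n k / (- s - \<i> * complex_of_real (p n)) ^ k)" if k': "k \<in> {1..r n}" for n k
  proof -
    obtain j where k: "k = Suc j" using k' by (cases k) auto
    have "- s - \<i> * complex_of_real (p n) = - 1 * (s - \<i> * complex_of_real (- p n))" by simp
    then have "(- s - \<i> * complex_of_real (p n)) ^ k = (- 1) ^ k * (s - \<i> * complex_of_real (- p n)) ^ k"
      by (simp only: power_mult_distrib)
    then show ?thesis by (cases "even j") (simp_all add: k)
  qed
  then show ?thesis unfolding principal_parts_def sum_negf[symmetric] by (intro sum.cong refl) auto
qed

lemma exp_poly_continuous: "continuous_on S (exp_poly N p r c)"
  unfolding exp_poly_def by (intro continuous_intros) auto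

lemma locally_integrable_exp_poly: "locally_integrable (exp_poly N p r c)"
  unfolding locally_integrable_def
  using absolutely_integrable_continuous_real[OF exp_poly_continuous] by blast

lemma laplace_trunc_exp_poly:
  assumes s: "Re s > 0"
  shows "(laplace_trunc (exp_poly N p r c) s \<longlongrightarrow> principal_parts N p r c s) at_top"
proof -
  have "((\<lambda>T. \<Sum>n=1..N. \<Sum>k=1..r n. c n k *
       integral {0..T} (\<lambda>t. exp (- (s - \<i> * of_real (p n)) * of_real t) * (of_real t ^ (k - 1) / fact (k - 1))))
     \<longlongrightarrow> (\<Sum>n=1..N. \<Sum>k=1..r n. c n k * (1 / (s - \<i> * of_real (p n)) ^ Suc (k - 1)))) at_top"
    by (intro tendsto_sum tendsto_mult tendsto_const monomial_laplace_tendsto) (use s in simp)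
  also have "(\<Sum>n=1..N. \<Sum>k=1..r n. c n k * (1 / (s - \<i> * of_real (p n)) ^ Suc (k - 1))) = principal_parts N p r c s"
    unfolding principal_parts_def by (intro sum.cong refl) (simp add: Suc_diff_1 del: power_Suc)
  also have "(\<lambda>T. \<Sum>n=1..N. \<Sum>k=1..r n. c n k *
       integral {0..T} (\<lambda>t. exp (- (s - \<i> * of_real (p n)) * of_real t) * (of_real t ^ (k - 1) / fact (k - 1))))
      = laplace_trunc (exp_poly N p r c) s"
  proof
    fix T :: real
    have ii: "(\<lambda>t. exp (- w * of_real t) * (of_real t ^ j / fact j)) integrable_on {0..T}" for w :: complex and j
      by (intro integrable_continuous_interval continuous_intros) auto
    have "((\<lambda>t. \<Sum>n=1..N. \<Sum>k=1..r n. c n k *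
       (exp (- (s - \<i> * of_real (p n)) * of_real t) * (of_real t ^ (k - 1) / fact (k - 1)))) has_integral
       (\<Sum>n=1..N. \<Sum>k=1..r n. c n k *
       integral {0..T} (\<lambda>t. exp (- (s - \<i> * of_real (p n)) * of_real t) * (of_real t ^ (k - 1) / fact (k - 1))))) {0..T}"
      by (intro has_integral_sum has_integral_mult_right integrable_integral ii) auto
    moreover have "(\<Sum>n=1..N. \<Sum>k=1..r n. c n k *
       (exp (- (s - \<i> * of_real (p n)) * of_real t) * (of_real t ^ (k - 1) / fact (k - 1)))) =
       exp (- s * of_real t) * exp_poly N p r c t" for t :: real
    proof -
      have "exp (- (s - \<i> * of_real (p n)) * of_real t) = exp (- s * of_real t) * exp (\<i> * of_real (p n) * of_real t)" for n
        by (simp add: mult_exp_exp algebra_simps)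
      then show ?thesis unfolding exp_poly_def sum_distrib_left
        by (intro sum.cong refl) (simp add: mult_ac)
    qed
    ultimately show "(\<Sum>n=1..N. \<Sum>k=1..r n. c n k *
       integral {0..T} (\<lambda>t. exp (- (s - \<i> * of_real (p n)) * of_real t) * (of_real t ^ (k - 1) / fact (k - 1))))
      = laplace_trunc (exp_poly N p r c) s T"
      by (simp add: laplace_trunc_def integral_unique)
  qed
  finally show ?thesis .
qed

lemma AE_lebesgue_reflect:
  fixes P :: "real \<Rightarrow> bool"
  assumes "AE t in lebesgue. P t"
  shows "AE t in lebesgue. P (- t)"
proof -
  obtain N where N: "N \<in> null_sets lebesgue" "{t. \<not> P t} \<subseteq> N"
    using assms by (auto simp: eventually_ae_filter)
  have "negligible (uminus ` N)"
    using N(1) by (intro negligible_differentiable_image_negligible)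
      (auto simp: negligible_iff_null_sets intro!: derivative_intros)
  then show ?thesis
    by (intro AE_I'[of "uminus ` N"]) (use N(2) in \<open>force simp: negligible_iff_null_sets\<close>)+
qed

lemma principal_parts_holomorphic:
  assumes "\<And>n. n \<in> {1..N} \<Longrightarrow> \<i> * complex_of_real (p n) \<notin> S"
  shows "principal_parts N p r c holomorphic_on S"
  unfolding principal_parts_def using assms by (intro holomorphic_intros) auto

lemma principal_parts_bound:
  assumes "\<delta> > 0" and "\<And>n. n \<in> {1..N} \<Longrightarrow> norm (s - \<i> * complex_of_real (p n)) \<ge> \<delta>"
  shows "norm (principal_parts N p r c s) \<le> (\<Sum>n=1..N. \<Sum>k=1..r n. norm (c n k) / \<delta> ^ k)"
  unfolding principal_parts_def
  by (intro order.trans[OF norm_sum] sum_mono)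
     (use assms in \<open>auto simp: norm_divide norm_power intro!: divide_left_mono power_mono mult_pos_pos zero_less_power
        intro: less_le_trans\<close>)

text \<open>In degrees from \<open>- m\<close> to \<open>- 1\<close> the Laurent coefficients
  cancel, and below \<open>- m\<close> there are none, since \<open>m\<close> is the pole order. The
  difference has nonnegative subdegree and hence a limit.\<close>

lemma principal_part_tendsto:
  assumes F: "F meromorphic_on {z}" and pole: "is_pole F z"
    and m: "int m = - zorder F z"
    and a: "\<And>k. k \<in> {1..m} \<Longrightarrow> a k = fls_nth (laurent_expansion F z) (- int k)"
  shows "\<exists>l. ((\<lambda>s. F s - (\<Sum>k=1..m. a k / (s - z) ^ k)) \<longlongrightarrow> l) (at z)"
proof -
  let ?L = "laurent_expansion F z"
  have L: "(\<lambda>w. F (z + w)) has_laurent_expansion ?L"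
    using F by (intro not_essential_has_laurent_expansion meromorphic_on_isolated_singularity meromorphic_on_not_essential)
  have neg: "fls_subdegree ?L < 0" using pole has_laurent_expansion_imp_is_pole_iff[OF L] by simp
  then have "?L \<noteq> 0" by auto
  then have m_eq: "fls_subdegree ?L = - int m" using has_laurent_expansion_zorder[OF L] m by simp
  let ?S = "\<Sum>k=1..m. fls_const (a k) * fls_X_inv ^ k"
  have "(\<lambda>w. F (z + w) - (\<Sum>k=1..m. a k * inverse w ^ k)) has_laurent_expansion ?L - ?S"
    by (intro laurent_expansion_intros L)
  then have H: "(\<lambda>w. (\<lambda>s. F s - (\<Sum>k=1..m. a k / (s - z) ^ k)) (z + w)) has_laurent_expansion ?L - ?S"
    by (simp add: field_simps)
  have "fls_subdegree (?L - ?S) \<ge> 0"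
  proof (rule fls_subdegree_ge0I)
    fix j :: int assume j: "j < 0"
    have "fls_nth ?S j = (\<Sum>k=1..m. if j = - int k then a k else 0)"
      unfolding fls_nth_sum by (intro sum.cong refl) auto
    also have "\<dots> = (\<Sum>k=1..m. if k = nat (- j) then a k else 0)"
      by (intro sum.cong refl) (use j in auto)
    also have "\<dots> = (if nat (- j) \<in> {1..m} then a (nat (- j)) else 0)" by (simp add: sum.delta)
    also have "\<dots> = fls_nth ?L j"
    proof (cases "nat (- j) \<in> {1..m}")
      case True then show ?thesis using a[OF True] j by simp
    next
      case False
      then have "fls_nth ?L j = 0" using j m_eq by (intro fls_eq0_below_subdegree) auto
      then show ?thesis using False by (simp only: if_False)
    qed
    finally show "fls_nth (?L - ?S) j = 0" by simp
  qed
  from has_laurent_expansion_imp_tendsto[OF H this] show ?thesis by blast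
qed

text \<open>By injectivity of \<open>p\<close> only one principal part is singular at a given pole,
  and it cancels the singularity of \<open>F\<close>; the others are continuous there. Away from the
  poles all of them are.\<close>

lemma minus_principal_parts_not_pole:
  assumes F: "F meromorphic_on {z}" and inj: "inj_on p {1..N}"
    and poles: "is_pole F z \<Longrightarrow> z \<in> (\<lambda>n. \<i> * complex_of_real (p n)) ` {1..N}"
    and is_pole: "\<And>n. n \<in> {1..N} \<Longrightarrow> z = \<i> * complex_of_real (p n) \<Longrightarrow> is_pole F z"
    and r: "\<And>n. n \<in> {1..N} \<Longrightarrow> int (r n) = - zorder F (\<i> * complex_of_real (p n))"
    and c: "\<And>n k. n \<in> {1..N} \<Longrightarrow> k \<in> {1..r n} \<Longrightarrow>
           c n k = fls_nth (laurent_expansion F (\<i> * complex_of_real (p n))) (- int k)"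
  shows "\<not> is_pole (\<lambda>s. F s - principal_parts N p r c s) z"
proof -
  have "\<exists>l. ((\<lambda>s. F s - principal_parts N p r c s) \<longlongrightarrow> l) (at z)"
  proof (cases "is_pole F z")
    case True
    then obtain m where m: "m \<in> {1..N}" "z = \<i> * complex_of_real (p m)" using poles by blast
    let ?R = "\<lambda>s. \<Sum>n\<in>{1..N} - {m}. \<Sum>k=1..r n. c n k / (s - \<i> * complex_of_real (p n)) ^ k"
    have eq: "principal_parts N p r c s = (\<Sum>k=1..r m. c m k / (s - z) ^ k) + ?R s" for s
      unfolding principal_parts_def using m by (subst sum.remove[of _ m]) auto
    obtain l where l: "((\<lambda>s. F s - (\<Sum>k=1..r m. c m k / (s - z) ^ k)) \<longlongrightarrow> l) (at z)"
      using principal_part_tendsto[OF F True, of "r m" "c m"] r[OF m(1)] c[OF m(1)] m(2) by blast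
    have "z \<noteq> \<i> * complex_of_real (p n)" if "n \<in> {1..N} - {m}" for n
      using inj_onD[OF inj, of n m] that m by auto
    then have "(?R \<longlongrightarrow> ?R z) (at z)" by (intro tendsto_intros) auto
    from tendsto_diff[OF l this] show ?thesis unfolding eq by (auto simp: algebra_simps)
  next
    case False
    then obtain l where l: "(F \<longlongrightarrow> l) (at z)"
      using meromorphic_on_not_essential[OF F] unfolding not_essential_def by blast
    have "z \<noteq> \<i> * complex_of_real (p n)" if "n \<in> {1..N}" for n using is_pole[OF that] False by blast
    then have "(principal_parts N p r c \<longlongrightarrow> principal_parts N p r c z) (at z)"
      unfolding principal_parts_def by (intro tendsto_intros) auto
    from tendsto_diff[OF l this] show ?thesis by blast
  qed
  then show ?thesis unfolding is_pole_def using not_tendsto_and_filterlim_at_infinity[of "at z"] by auto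
qed

text \<open>A meromorphic function may have wrong values at isolated points, and at the poles the
  difference has no meaningful value, so analyticity is claimed only after
  \<open>remove_sings\<close>.\<close>

lemma minus_principal_parts_analytic:
  assumes "F meromorphic_on S" and "inj_on p {1..N}"
    and poles: "{z \<in> S. is_pole F z} = (\<lambda>n. \<i> * complex_of_real (p n)) ` {1..N}"
    and "\<And>n. n \<in> {1..N} \<Longrightarrow> int (r n) = - zorder F (\<i> * complex_of_real (p n))"
    and "\<And>n k. n \<in> {1..N} \<Longrightarrow> k \<in> {1..r n} \<Longrightarrow>
           c n k = fls_nth (laurent_expansion F (\<i> * complex_of_real (p n))) (- int k)"
  shows "remove_sings (\<lambda>s. F s - principal_parts N p r c s) analytic_on S"
proof -
  let ?H = "\<lambda>s. F s - principal_parts N p r c s"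
  have mero: "?H meromorphic_on S"
    unfolding principal_parts_def by (intro meromorphic_intros assms(1))
  have "\<not> is_pole (remove_sings ?H) z" if "z \<in> S" for z
  proof -
    have "\<not> is_pole ?H z"
      by (rule minus_principal_parts_not_pole)
         (use assms that meromorphic_on_subset[OF assms(1)] poles in blast)+
    moreover have "isolated_singularity_at ?H z"
      by (rule meromorphic_on_isolated_singularity) (use mero meromorphic_on_subset that in blast)
    ultimately show ?thesis by simp
  qed
  with remove_sings_nicely_meromorphic[OF mero] show ?thesis
    using nicely_meromorphic_without_singularities by blast
qed

section \<open>The jump formula\<close>

lemma laplace_diff:
  assumes "\<And>T. f absolutely_integrable_on {0..T}" "\<And>T. g absolutely_integrable_on {0..T}"
    and "(laplace_trunc f s \<longlongrightarrow> K) at_top" "(laplace_trunc g s \<longlongrightarrow> L) at_top"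
  shows "(laplace_trunc (\<lambda>t. f t - g t) s \<longlongrightarrow> K - L) at_top"
  unfolding laplace_trunc_diff[OF assms(1,2)] using assms(3,4) by (rule tendsto_diff)

text \<open>Absorbs the linear growth of the half-line transforms into the doubly exponential bound
  that the Phragmen-Lindelof argument accepts.\<close>

lemma one_plus_le_exp_exp:
  fixes K y :: real
  assumes "K > 0"
  shows "1 + \<bar>y\<bar> \<le> (1 + 1 / K) * exp (exp (K * \<bar>y\<bar>))"
proof -
  have 1: "1 + x \<le> exp x" for x :: real by (rule exp_ge_add_one_self)
  have "K * \<bar>y\<bar> \<le> exp (K * \<bar>y\<bar>)" using 1[of "K * \<bar>y\<bar>"] by linarith
  also have "\<dots> \<le> exp (exp (K * \<bar>y\<bar>))" using 1[of "exp (K * \<bar>y\<bar>)"] by linarith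
  finally have "\<bar>y\<bar> \<le> 1 / K * exp (exp (K * \<bar>y\<bar>))" using assms by (simp add: field_simps)
  moreover have "1 \<le> exp (exp (K * \<bar>y\<bar>))" by simp
  ultimately show ?thesis unfolding distrib_right by linarith
qed

theorem lemma3p4:
  fixes F :: "complex \<Rightarrow> complex"
    and f\<^sub>l f\<^sub>r :: "real \<Rightarrow> complex"
    and a b :: ereal
    and N :: nat
    and p :: "nat \<Rightarrow> real"
    and r :: "nat \<Rightarrow> nat"
    and c :: "nat \<Rightarrow> nat \<Rightarrow> complex"
  assumes "a < 0" and "0 < b"
    and "meromorphic_laplace_pair F f\<^sub>l f\<^sub>r a b"
    and "phragmen_lindelof F a b"
    and "inj_on p {1..N}"
    and "{z \<in> vertical_strip a b. is_pole F z} = (\<lambda>n. \<i> * complex_of_real (p n)) ` {1..N}"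
    and "\<And>n. n \<in> {1..N} \<Longrightarrow> int (r n) = - zorder F (\<i> * complex_of_real (p n))"
    and "\<And>n k. n \<in> {1..N} \<Longrightarrow> k \<in> {1..r n} \<Longrightarrow>
           c n k = fls_nth (laurent_expansion F (\<i> * complex_of_real (p n))) (- int k)"
  shows "AE t in lebesgue.
           f\<^sub>r t - f\<^sub>l t =
             (\<Sum>n=1..N. exp (\<i> * complex_of_real (p n) * complex_of_real t) *
               (\<Sum>k=1..r n. c n k * complex_of_real t ^ (k - 1) / fact (k - 1)))"
proof -
  have mero: "F meromorphic_on vertical_strip a b"
    and fl: "locally_integrable f\<^sub>l" and fr: "locally_integrable f\<^sub>r"
    and Fl: "\<And>s. s \<in> vertical_strip a 0 \<Longrightarrow> has_bilateral_laplace f\<^sub>l s (F s)"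
    and Fr: "\<And>s. s \<in> vertical_strip 0 b \<Longrightarrow> has_bilateral_laplace f\<^sub>r s (F s)"
    using assms(3) unfolding meromorphic_laplace_pair_def by blast+
  obtain A B Y K :: real where ABYK: "A > 0" "B > 0" "Y > 0" "0 < K"
    and PL: "\<And>x y. a < ereal x \<Longrightarrow> ereal x < b \<Longrightarrow> \<bar>y\<bar> \<ge> Y \<Longrightarrow>
      norm (F (Complex x y)) \<le> A * exp (B * exp (K * \<bar>y\<bar>))"
    using assms(4) unfolding phragmen_lindelof_def by blast
  obtain d1 where d1: "0 < ereal d1" "ereal d1 < b" using ereal_dense2[OF assms(2)] by blast
  obtain d2 where d2: "a < ereal d2" "ereal d2 < 0" using ereal_dense2[OF assms(1)] by blast
  \<comment> \<open>The first two entries put the closed strip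
    \<open>\<bar>Re s\<bar> \<le> 2 * e\<close> inside the given one, \<open>1 / 2\<close> yields
    \<open>e < 1\<close> for the divisor \<open>w + 2\<close>, and \<open>pi / (4 * K)\<close>
    yields \<open>K * e < pi / 2\<close>.\<close>
  define e where "e = min (min (d1 / 2) (- d2 / 2)) (min (1 / 2) (pi / (4 * K)))"
  have e0: "e > 0" using d1 d2 ABYK pi_gt_zero by (simp add: e_def)
  have e1: "e < 1" and "2 * e \<le> d1" "d2 \<le> - 2 * e" and eK: "e \<le> pi / (4 * K)"
    unfolding e_def by linarith+
  then have ea: "a < ereal (- 2 * e)" and eb: "ereal (2 * e) < b"
    using d1 d2 by (metis ereal_less_eq(3) less_le_trans le_less_trans)+
  have Ke: "K * e < pi / 2"
  proof -
    have "K * e \<le> pi / 4" using eK ABYK by (simp add: field_simps)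
    then show ?thesis using pi_gt_zero by linarith
  qed
  have strip: "s \<in> vertical_strip a b" if "\<bar>Re s\<bar> \<le> 2 * e" for s
  proof -
    have "- 2 * e \<le> Re s" "Re s \<le> 2 * e" using that by auto
    then show ?thesis unfolding vertical_strip_def using ea eb
      by (metis (mono_tags, lifting) ereal_less_eq(3) le_less_trans less_le_trans mem_Collect_eq)
  qed
  have strip_r: "s \<in> vertical_strip 0 b" if "0 < Re s" "Re s \<le> 2 * e" for s
    using strip[of s] that by (simp add: vertical_strip_def)
  have strip_l: "s \<in> vertical_strip a 0" if "- 2 * e \<le> Re s" "Re s < 0" for s
    using strip[of s] that by (simp add: vertical_strip_def)

  \<comment> \<open>Half-line transforms of both functions and of their difference\<close>
  define gl gr where "gl = (\<lambda>t. f\<^sub>l (- t))" and "gr = (\<lambda>t. f\<^sub>r (- t))"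
  have ai: "f\<^sub>l absolutely_integrable_on {0..T}" "f\<^sub>r absolutely_integrable_on {0..T}"
    "gl absolutely_integrable_on {0..T}" "gr absolutely_integrable_on {0..T}" for T
    using fl fr locally_integrable_reflect[OF fl] locally_integrable_reflect[OF fr]
    unfolding gl_def gr_def by (simp_all add: locally_integrable_def)
  have tr: "(laplace_trunc f\<^sub>r s \<longlongrightarrow> laplace f\<^sub>r s) at_top"
    "(laplace_trunc gr (- s) \<longlongrightarrow> laplace gr (- s)) at_top"
    "F s = laplace f\<^sub>r s + laplace gr (- s)" if "0 < Re s" "Re s \<le> 2 * e" for s
    by (rule has_bilateral_laplace_split[OF fr Fr[OF strip_r[OF that]]];
        simp add: gr_def laplace_eqI)+
  have tl: "(laplace_trunc f\<^sub>l s \<longlongrightarrow> laplace f\<^sub>l s) at_top"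
    "(laplace_trunc gl (- s) \<longlongrightarrow> laplace gl (- s)) at_top"
    "F s = laplace f\<^sub>l s + laplace gl (- s)" if "- 2 * e \<le> Re s" "Re s < 0" for s
    by (rule has_bilateral_laplace_split[OF fl Fl[OF strip_l[OF that]]];
        simp add: gl_def laplace_eqI)+
  \<comment> \<open>The base points reflect where convergence is known. For \<open>f\<^sub>r\<close>
    and \<open>gl\<close> it stops at the axis, so a point at distance \<open>e / 2\<close> is
    taken. For \<open>gr\<close> and \<open>f\<^sub>l\<close> it reaches past the axis, so
    \<open>- 2 * e\<close> is available and their contributions are holomorphic across it.\<close>
  have base_r: "(laplace_trunc f\<^sub>r (of_real (e / 2)) \<longlongrightarrow> laplace f\<^sub>r (of_real (e / 2))) at_top"
    by (rule tr(1)) (use e0 in auto)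
  have base_gr: "(laplace_trunc gr (of_real (- 2 * e)) \<longlongrightarrow> laplace gr (of_real (- 2 * e))) at_top"
    using tr(2)[of "of_real (2 * e)"] e0 by simp
  have base_l: "(laplace_trunc f\<^sub>l (of_real (- 2 * e)) \<longlongrightarrow> laplace f\<^sub>l (of_real (- 2 * e))) at_top"
    by (rule tl(1)) (use e0 in auto)
  have base_gl: "(laplace_trunc gl (of_real (e / 2)) \<longlongrightarrow> laplace gl (of_real (e / 2))) at_top"
    using tl(2)[of "of_real (- e / 2)"] e0 by simp

  define D D' where "D = (\<lambda>t. f\<^sub>r t - f\<^sub>l t)" and "D' = (\<lambda>t. gr t - gl t)"
  have Dai: "D absolutely_integrable_on {0..T}" "D' absolutely_integrable_on {0..T}" for T
    unfolding D_def D'_def using ai[of T] by (auto intro: set_integral_diff)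
  have D_base: "(laplace_trunc D (of_real (e / 2)) \<longlongrightarrow> laplace f\<^sub>r (of_real (e / 2)) - laplace f\<^sub>l (of_real (e / 2))) at_top"
    unfolding D_def by (rule laplace_diff[OF ai(2,1) base_r laplace_tendsto[OF ai(1) base_l]]) (use e0 in simp)
  have D'_base: "(laplace_trunc D' (of_real (e / 2)) \<longlongrightarrow> laplace gr (of_real (e / 2)) - laplace gl (of_real (e / 2))) at_top"
    unfolding D'_def by (rule laplace_diff[OF ai(4,3) laplace_tendsto[OF ai(4) base_gr] base_gl]) (use e0 in simp)
  have D_eq: "laplace D s = laplace f\<^sub>r s - laplace f\<^sub>l s" if "Re s > e / 2" for s
    unfolding D_def
    by (rule laplace_eqI, rule laplace_diff[OF ai(2,1) laplace_tendsto[OF ai(2) base_r] laplace_tendsto[OF ai(1) base_l]])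
       (use e0 that in simp_all)
  have D'_eq: "laplace D' s = laplace gr s - laplace gl s" if "Re s > e / 2" for s
    unfolding D'_def
    by (rule laplace_eqI, rule laplace_diff[OF ai(4,3) laplace_tendsto[OF ai(4) base_gr] laplace_tendsto[OF ai(3) base_gl]])
       (use e0 that in simp_all)

  \<comment> \<open>Gluing to an entire function\<close>
  let ?P = "principal_parts N p r c"
  define Q where "Q = remove_sings (\<lambda>s. F s - ?P s)"
  have Q: "Q analytic_on vertical_strip a b"
    unfolding Q_def by (rule minus_principal_parts_analytic[OF mero assms(5-8)])
  have Re_pole: "Re (\<i> * complex_of_real (p n)) = 0" for n by simp
  have P_hol: "?P holomorphic_on S" if "\<And>s. s \<in> S \<Longrightarrow> Re s \<noteq> 0" for S
    by (rule principal_parts_holomorphic) (use that Re_pole in metis)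
  have hol_D: "laplace D holomorphic_on {s. Re s > e / 2}"
    and hol_D': "laplace D' holomorphic_on {s. Re s > e / 2}"
    and hol_l: "laplace f\<^sub>l holomorphic_on {s. Re s > - 2 * e}"
    and hol_gr: "laplace gr holomorphic_on {s. Re s > - 2 * e}"
    using laplace_holomorphic[OF Dai(1) D_base]
      laplace_holomorphic[OF Dai(2) D'_base] laplace_holomorphic[OF ai(1) base_l]
      laplace_holomorphic[OF ai(4) base_gr] by simp_all
  have refl_hol: "(\<lambda>s. laplace g (- s)) holomorphic_on {s. Re s < - x}" if "laplace g holomorphic_on {s. Re s > x}" for g x
  proof -
    have "laplace g \<circ> (\<lambda>s. - s) holomorphic_on {s. Re s < - x}"
      by (rule holomorphic_on_compose_gen[OF _ that]) (auto intro!: holomorphic_intros)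
    then show ?thesis by (simp add: o_def)
  qed
  \<comment> \<open>Off the axis \<open>F\<close> is a sum of two holomorphic half-line transforms,
    so \<open>remove_sings\<close> does not alter the value. The auxiliary \<open>x\<close> is a
    base point halfway between the axis and \<open>s\<close>, reflected on the left side.\<close>
  have Q_eq: "Q s = F s - ?P s" if "Re s \<noteq> 0" "\<bar>Re s\<bar> < 2 * e" for s
  proof -
    have "(\<lambda>s. F s - ?P s) analytic_on {s}"
    proof (cases "Re s > 0")
      case True
      define x where "x = Re s / 2"
      have x: "0 < x" "x < Re s" "x \<le> 2 * e" using True that by (auto simp: x_def)
      let ?S = "{s. Re s > x} \<inter> {s. Re s < 2 * e}"
      have hol_r: "laplace f\<^sub>r holomorphic_on {s. Re s > x}"
        using laplace_holomorphic[OF ai(2) tr(1)[of "of_real x"]] x by simp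
      have "(\<lambda>s. laplace f\<^sub>r s + laplace gr (- s) - ?P s) holomorphic_on ?S"
        by (intro holomorphic_intros P_hol holomorphic_on_subset[OF hol_r] holomorphic_on_subset[OF refl_hol[OF hol_gr]])
           (use x in auto)
      then have "(\<lambda>s. F s - ?P s) holomorphic_on ?S"
        by (rule holomorphic_transform) (use tr(3) x in auto)
      then show ?thesis
        by (rule holomorphic_on_imp_analytic_at)
           (use that x in \<open>auto intro: open_Int open_halfspace_Re_gt open_halfspace_Re_lt\<close>)
    next
      case False
      define x where "x = - Re s / 2"
      have x: "0 < x" "x < - Re s" "x \<le> 2 * e" using False that by (auto simp: x_def)
      let ?S = "{s. Re s < - x} \<inter> {s. Re s > - 2 * e}"
      have hol_gl: "laplace gl holomorphic_on {s. Re s > x}"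
        using laplace_holomorphic[OF ai(3) tl(2)[of "- of_real x"]] x by simp
      have "(\<lambda>s. laplace f\<^sub>l s + laplace gl (- s) - ?P s) holomorphic_on ?S"
        by (intro holomorphic_intros P_hol holomorphic_on_subset[OF hol_l] holomorphic_on_subset[OF refl_hol[OF hol_gl]])
           (use x in auto)
      then have "(\<lambda>s. F s - ?P s) holomorphic_on ?S"
        by (rule holomorphic_transform) (use tl(3) x in auto)
      then show ?thesis
        by (rule holomorphic_on_imp_analytic_at)
           (use that x in \<open>auto intro: open_Int open_halfspace_Re_gt open_halfspace_Re_lt\<close>)
    qed
    then show ?thesis unfolding Q_def by simp
  qed

  define G where "G s = (if Re s > e then laplace D s - ?P s else
      if Re s < - e then - laplace D' (- s) - ?P s else Q s - laplace gr (- s) - laplace f\<^sub>l s)" for s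
  \<comment> \<open>The cuts at \<open>e\<close> and \<open>- e\<close> are immaterial: the three
    formulas agree wherever \<open>e / 2 < \<bar>Re s\<bar> < 2 * e\<close>, by the decompositions
    of \<open>F\<close> on either side. Each therefore holds on an open set, and these sets cover
    the plane.\<close>
  have G1: "G s = laplace D s - ?P s" if "Re s > e / 2" for s
    using that e0 by (auto simp: G_def Q_eq tr(3) D_eq)
  have G2: "G s = - laplace D' (- s) - ?P s" if "Re s < - e / 2" for s
    using that e0 by (auto simp: G_def Q_eq tl(3) D'_eq)
  have G3: "G s = Q s - laplace gr (- s) - laplace f\<^sub>l s" if "\<bar>Re s\<bar> < 2 * e" for s
    using that e0 by (auto simp: G_def Q_eq tl(3) tr(3) D_eq D'_eq)
  have G_hol: "G holomorphic_on UNIV"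
  proof -
    have 1: "G holomorphic_on {s. Re s > e / 2}"
    proof (rule holomorphic_transform)
      show "(\<lambda>s. laplace D s - ?P s) holomorphic_on {s. Re s > e / 2}"
        by (intro holomorphic_intros hol_D P_hol) (use e0 in auto)
    qed (use G1 in auto)
    have 2: "G holomorphic_on {s. Re s < - (e / 2)}"
    proof (rule holomorphic_transform)
      show "(\<lambda>s. - laplace D' (- s) - ?P s) holomorphic_on {s. Re s < - (e / 2)}"
        by (intro holomorphic_intros refl_hol hol_D' P_hol) (use e0 in auto)
    qed (use G2 in auto)
    have 3: "G holomorphic_on {s. Re s < 2 * e} \<inter> {s. Re s > - 2 * e}"
    proof (rule holomorphic_transform[of "\<lambda>s. Q s - laplace gr (- s) - laplace f\<^sub>l s"])
      have "Q holomorphic_on {s. Re s < 2 * e} \<inter> {s. Re s > - 2 * e}"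
        by (rule holomorphic_on_subset[OF analytic_imp_holomorphic[OF Q]]) (use strip in auto)
      then show "(\<lambda>s. Q s - laplace gr (- s) - laplace f\<^sub>l s) holomorphic_on {s. Re s < 2 * e} \<inter> {s. Re s > - 2 * e}"
        by (intro holomorphic_intros holomorphic_on_subset[OF hol_l] holomorphic_on_subset[OF refl_hol[OF hol_gr]])
           auto
    qed (use G3 in auto)
    have "G holomorphic_on ({s. Re s > e / 2} \<union> {s. Re s < - (e / 2)}) \<union> ({s. Re s < 2 * e} \<inter> {s. Re s > - 2 * e})"
      by (intro holomorphic_on_Un 1 2 3 open_Un open_Int open_halfspace_Re_gt open_halfspace_Re_lt)
    moreover have "({s. Re s > e / 2} \<union> {s. Re s < - (e / 2)}) \<union> ({s. Re s < 2 * e} \<inter> {s. Re s > - 2 * e}) = UNIV"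
      using e0 by auto
    ultimately show ?thesis by simp
  qed

  \<comment> \<open>Growth of the glued function\<close>
  have lap_bound: "\<exists>M\<ge>0. \<forall>s. Re s \<ge> x + d \<longrightarrow> norm (laplace f s) \<le> M * (1 + norm s)"
    if f: "\<And>T. f absolutely_integrable_on {0..T}" and lim: "(laplace_trunc f (of_real x) \<longlongrightarrow> L) at_top" and d: "d > 0"
    for f x d L
  proof -
    obtain M where M: "M \<ge> 0"
      "\<And>s. Re s > x \<Longrightarrow> norm (laplace f s) \<le> M * norm (s - of_real x) / (Re s - x)"
      using laplace_bound[OF f lim] by (metis Re_complex_of_real)
    have "norm (laplace f s) \<le> (M * (1 + \<bar>x\<bar>) / d) * (1 + norm s)" if s: "Re s \<ge> x + d" for s
    proof -
      have "norm (s - of_real x) \<le> norm s + \<bar>x\<bar>" using norm_triangle_ineq4[of s "of_real x"] by simp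
      also have "\<dots> \<le> (1 + \<bar>x\<bar>) * (1 + norm s)" by (simp add: algebra_simps)
      finally have *: "M * norm (s - of_real x) \<le> M * ((1 + \<bar>x\<bar>) * (1 + norm s))"
        using M(1) by (rule mult_left_mono)
      have "norm (laplace f s) \<le> M * norm (s - of_real x) / (Re s - x)" using M(2) s d by simp
      also have "\<dots> \<le> M * ((1 + \<bar>x\<bar>) * (1 + norm s)) / d"
        using s d M(1) by (intro frac_le * mult_nonneg_nonneg) auto
      finally show ?thesis by simp
    qed
    moreover have "M * (1 + \<bar>x\<bar>) / d \<ge> 0" using M d by simp
    ultimately show ?thesis by blast
  qed
  \<comment> \<open>Bounds the principal parts at distance at least \<open>\<delta>\<close> from all
    poles: \<open>\<delta> = e\<close> away from the axis, \<open>\<delta> = 1\<close> high up in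
    the strip.\<close>
  define PB where "PB \<delta> = (\<Sum>n=1..N. \<Sum>k=1..r n. norm (c n k) / \<delta> ^ k)" for \<delta> :: real
  have PB_nonneg: "PB \<delta> \<ge> 0" if "\<delta> > 0" for \<delta> using that by (auto simp: PB_def intro!: sum_nonneg)
  have P_bound_Re: "norm (?P s) \<le> PB e" if "\<bar>Re s\<bar> \<ge> e" for s
    unfolding PB_def
  proof (rule principal_parts_bound[OF e0])
    fix n
    show "e \<le> norm (s - \<i> * complex_of_real (p n))"
      using abs_Re_le_cmod[of "s - \<i> * complex_of_real (p n)"] that by simp
  qed
  \<comment> \<open>The sum dominates every \<open>\<bar>p n\<bar>\<close>, so beyond this height
    all poles are at distance at least \<open>1\<close>.\<close>
  define Y' where "Y' = max Y (1 + (\<Sum>n=1..N. \<bar>p n\<bar>))"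
  have P_bound_Im: "norm (?P s) \<le> PB 1" if "\<bar>Im s\<bar> \<ge> Y'" for s
    unfolding PB_def
  proof (rule principal_parts_bound)
    fix n assume n: "n \<in> {1..N}"
    have "\<bar>p n\<bar> \<le> (\<Sum>n=1..N. \<bar>p n\<bar>)" using n by (intro member_le_sum) auto
    then show "1 \<le> norm (s - \<i> * complex_of_real (p n))"
      using abs_Im_le_cmod[of "s - \<i> * complex_of_real (p n)"] abs_triangle_ineq2[of "Im s" "p n"] that
      by (simp add: Y'_def)
  qed simp
  obtain M1 where M1: "M1 \<ge> 0" "\<And>s. Re s \<ge> e \<Longrightarrow> norm (laplace D s) \<le> M1 * (1 + norm s)"
    using lap_bound[OF Dai(1) D_base, of "e / 2"] e0 by auto
  obtain M2 where M2: "M2 \<ge> 0" "\<And>s. Re s \<ge> e \<Longrightarrow> norm (laplace D' s) \<le> M2 * (1 + norm s)"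
    using lap_bound[OF Dai(2) D'_base, of "e / 2"] e0 by auto
  obtain M3 where M3: "M3 \<ge> 0" "\<And>s. Re s \<ge> - e \<Longrightarrow> norm (laplace gr s) \<le> M3 * (1 + norm s)"
    using lap_bound[OF ai(4) base_gr, of e] e0 by auto
  obtain M4 where M4: "M4 \<ge> 0" "\<And>s. Re s \<ge> - e \<Longrightarrow> norm (laplace f\<^sub>l s) \<le> M4 * (1 + norm s)"
    using lap_bound[OF ai(1) base_l, of e] e0 by auto

  define C where "C = M1 + M2 + PB e + 1"
  have C0: "C > 0" using M1 M2 PB_nonneg[OF e0] by (simp add: C_def)
  have G_out: "norm (G z) \<le> C * (1 + norm z)" if z: "\<bar>Re z\<bar> \<ge> e" for z
  proof -
    have P: "norm (?P z) \<le> PB e * (1 + norm z)"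
      using P_bound_Re[OF z] PB_nonneg[OF e0] mult_left_mono[of 1 "1 + norm z" "PB e"] by simp
    have "\<exists>w :: complex. norm (G z) \<le> norm w + norm (?P z) \<and> norm w \<le> (M1 + M2) * (1 + norm z)"
    proof (cases "Re z \<ge> e")
      case True
      have "norm (laplace D z) \<le> M1 * (1 + norm z)" by (rule M1(2)[OF True])
      also have "\<dots> \<le> (M1 + M2) * (1 + norm z)" using M2(1) by (intro mult_right_mono) auto
      finally show ?thesis using G1[of z] True e0 norm_triangle_ineq4[of "laplace D z" "?P z"]
        by (intro exI[of _ "laplace D z"]) auto
    next
      case False
      then have neg: "Re (- z) \<ge> e" using z by auto
      have "norm (laplace D' (- z)) \<le> M2 * (1 + norm z)" using M2(2)[OF neg] by simp
      also have "\<dots> \<le> (M1 + M2) * (1 + norm z)" using M1(1) by (intro mult_right_mono) auto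
      finally show ?thesis using G2[of z] neg e0 norm_triangle_ineq4[of "- laplace D' (- z)" "?P z"]
        by (intro exI[of _ "- laplace D' (- z)"]) auto
    qed
    then have "norm (G z) \<le> (M1 + M2) * (1 + norm z) + PB e * (1 + norm z)" using P by force
    also have "\<dots> \<le> C * (1 + norm z)" by (simp add: C_def algebra_simps)
    finally show ?thesis .
  qed

  \<comment> \<open>The summands come from \<open>F\<close>, the principal parts, and the two
    subtracted transforms, for which
    \<open>1 + norm z \<le> (1 + e) * (1 + \<bar>Im z\<bar>)\<close> in the strip. In the exponent,
    \<open>B + 1\<close> dominates both \<open>B\<close> and the \<open>1\<close> from absorbing the
    linear factor.\<close>
  define A' where "A' = A + PB 1 + (M3 + M4) * (1 + e) * (1 + 1 / K)"
  define \<Theta> where "\<Theta> y = A' * exp ((B + 1) * exp (K * \<bar>y\<bar>))" for y :: real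
  have A'0: "A' \<ge> 0"
    using ABYK M3 M4 e0 PB_nonneg[of 1] by (auto simp: A'_def intro!: add_nonneg_nonneg mult_nonneg_nonneg)
  have off_axis: "norm (G z) \<le> \<Theta> (Im z)" if z: "0 < \<bar>Re z\<bar>" "\<bar>Re z\<bar> \<le> e" "\<bar>Im z\<bar> \<ge> Y'" for z
  proof -
    let ?y = "\<bar>Im z\<bar>" and ?E = "exp ((B + 1) * exp (K * \<bar>Im z\<bar>))"
    have E1: "1 \<le> ?E" using ABYK by simp
    have "z \<in> vertical_strip a b" using strip z e0 by simp
    then have "norm (F z) \<le> A * exp (B * exp (K * ?y))"
      using PL[of "Re z" "Im z"] z(3) by (simp add: vertical_strip_def Y'_def)
    also have "\<dots> \<le> A * ?E" using ABYK by (intro mult_left_mono) auto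
    finally have 1: "norm (F z) \<le> A * ?E" .
    have 2: "norm (?P z) \<le> PB 1 * ?E"
      using P_bound_Im[OF z(3)] mult_left_mono[OF E1 PB_nonneg[of 1]] by simp
    have "0 \<le> e * ?y" using e0 by simp
    then have "1 + norm z \<le> (1 + e) * (1 + ?y)"
      using cmod_le[of z] z(2) unfolding distrib_left distrib_right by linarith
    also have "\<dots> \<le> (1 + e) * ((1 + 1 / K) * exp (exp (K * ?y)))"
      using one_plus_le_exp_exp[of K "Im z"] ABYK e0 by (intro mult_left_mono) auto
    also have "\<dots> \<le> (1 + e) * ((1 + 1 / K) * ?E)"
      using ABYK e0 by (intro mult_left_mono) auto
    finally have nz: "1 + norm z \<le> (1 + e) * ((1 + 1 / K) * ?E)" .
    have "norm (laplace gr (- z)) \<le> M3 * (1 + norm z)" using M3(2)[of "- z"] z by simp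
    also have "\<dots> \<le> M3 * ((1 + e) * ((1 + 1 / K) * ?E))" using nz M3(1) by (rule mult_left_mono)
    finally have 3: "norm (laplace gr (- z)) \<le> M3 * ((1 + e) * ((1 + 1 / K) * ?E))" .
    have "norm (laplace f\<^sub>l z) \<le> M4 * (1 + norm z)" using M4(2)[of z] z by simp
    also have "\<dots> \<le> M4 * ((1 + e) * ((1 + 1 / K) * ?E))" using nz M4(1) by (rule mult_left_mono)
    finally have 4: "norm (laplace f\<^sub>l z) \<le> M4 * ((1 + e) * ((1 + 1 / K) * ?E))" .
    have "G z = F z - ?P z - laplace gr (- z) - laplace f\<^sub>l z"
      using G3[of z] Q_eq[of z] z e0 by simp
    then have "norm (G z) \<le> norm (F z) + norm (?P z) + norm (laplace gr (- z)) + norm (laplace f\<^sub>l z)"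
      using norm_triangle_ineq4[of "F z - ?P z - laplace gr (- z)" "laplace f\<^sub>l z"]
        norm_triangle_ineq4[of "F z - ?P z" "laplace gr (- z)"] norm_triangle_ineq4[of "F z" "?P z"] by simp
    also have "\<dots> \<le> A * ?E + PB 1 * ?E + M3 * ((1 + e) * ((1 + 1 / K) * ?E)) + M4 * ((1 + e) * ((1 + 1 / K) * ?E))"
      by (intro add_mono 1 2 3 4)
    also have "\<dots> = \<Theta> (Im z)" by (simp only: \<Theta>_def A'_def distrib_left distrib_right mult.assoc)
    finally show ?thesis .
  qed
  have G_strip: "norm (G z) \<le> A' * exp ((B + 1) * exp (K * \<bar>Im z\<bar>))" if z: "\<bar>Re z\<bar> < e" "\<bar>Im z\<bar> \<ge> Y'" for z
  proof (cases "Re z = 0")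
    case True
    have "isCont G z"
      using holomorphic_on_imp_continuous_on[OF G_hol] by (simp add: continuous_on_eq_continuous_at)
    moreover have "((\<lambda>x. z + complex_of_real x) \<longlongrightarrow> z + of_real 0) (at_right 0)" by (intro tendsto_intros)
    ultimately have "((\<lambda>x. norm (G (z + complex_of_real x))) \<longlongrightarrow> norm (G z)) (at_right 0)"
      by (intro tendsto_norm isCont_tendsto_compose[of _ G]) auto
    moreover have "\<forall>\<^sub>F x in at_right 0. norm (G (z + complex_of_real x)) \<le> \<Theta> (Im z)"
      unfolding eventually_at_right_field
      by (rule exI[of _ e]) (use off_axis[of "z + of_real x" for x] e0 True z in auto)
    ultimately show ?thesis unfolding \<Theta>_def by (rule tendsto_upperbound) simp
  next
    case False
    then show ?thesis using off_axis[of z] z by (simp add: \<Theta>_def)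
  qed
  have lin: "norm (G z) \<le> 8 * C * (1 + norm z)" for z
    by (rule entire_linear_growth[OF G_hol e0 e1 C0 G_out G_strip]) (use A'0 ABYK Ke in auto)
  obtain M where M: "\<And>s. Re s > e / 2 \<Longrightarrow> norm (laplace D s) \<le> M * norm (s - of_real (e / 2)) / (Re s - e / 2)"
    using laplace_bound[OF Dai(1) D_base] by (metis Re_complex_of_real)
  have real_bound: "norm (G (of_real x)) \<le> M + PB e" if "x \<ge> 1" for x
  proof -
    have x: "x > e / 2" "x \<ge> e" using that e0 e1 by auto
    \<comment> \<open>On the real ray to the right of the real base point the quotient in the bound
      is exactly \<open>1\<close>.\<close>
    have "norm (complex_of_real x - of_real (e / 2)) = x - e / 2"
      unfolding of_real_diff[symmetric] norm_of_real using x by simp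
    then have "norm (laplace D (of_real x)) \<le> M" using M[of "of_real x"] x by simp
    moreover have "norm (?P (of_real x)) \<le> PB e" using P_bound_Re[of "of_real x"] x by simp
    ultimately show ?thesis
      using G1[of "of_real x"] x norm_triangle_ineq4[of "laplace D (of_real x)" "?P (of_real x)"] by simp
  qed
  have const: "G z = G 0" for z
    by (rule entire_linear_growth_const[OF G_hol lin real_bound])

  \<comment> \<open>Uniqueness on both half lines\<close>
  let ?E = "exp_poly N p r c"
  let ?E' = "exp_poly N (\<lambda>n. - p n) r (\<lambda>n k. c n k * (- 1) ^ (k - 1))"
  have Eai: "exp_poly N p r c absolutely_integrable_on {0..T}" for p c T
    using locally_integrable_exp_poly[of N p r c] by (simp add: locally_integrable_def)
  have pos: "AE t in lebesgue. t \<ge> 0 \<longrightarrow> D t - ?E t = 0"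
  proof (rule laplace_const_imp_AE_zero)
    show "(\<lambda>t. D t - ?E t) absolutely_integrable_on {0..T}" for T
      using Dai(1) Eai by (rule set_integral_diff)
    fix x :: real assume "x \<ge> 1"
    then have x: "x > e / 2" "x > 0" using e1 by auto
    have "(laplace_trunc (\<lambda>t. D t - ?E t) (of_real x) \<longlongrightarrow> laplace D (of_real x) - ?P (of_real x)) at_top"
      by (intro laplace_diff Dai Eai laplace_tendsto[OF Dai(1) D_base] laplace_trunc_exp_poly) (use x in auto)
    then show "(laplace_trunc (\<lambda>t. D t - ?E t) (of_real x) \<longlongrightarrow> G 0) at_top"
      using G1[of "of_real x"] const[of "of_real x"] x by simp
  qed
  have neg: "AE t in lebesgue. t \<ge> 0 \<longrightarrow> D' t - ?E' t = 0"
  proof (rule laplace_const_imp_AE_zero)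
    show "(\<lambda>t. D' t - ?E' t) absolutely_integrable_on {0..T}" for T
      using Dai(2) Eai by (rule set_integral_diff)
    fix x :: real assume "x \<ge> 1"
    then have x: "x > e / 2" "x > 0" using e1 by auto
    have "(laplace_trunc (\<lambda>t. D' t - ?E' t) (of_real x) \<longlongrightarrow>
        laplace D' (of_real x) - principal_parts N (\<lambda>n. - p n) r (\<lambda>n k. c n k * (- 1) ^ (k - 1)) (of_real x)) at_top"
      by (intro laplace_diff Dai Eai laplace_tendsto[OF Dai(2) D'_base] laplace_trunc_exp_poly) (use x in auto)
    \<comment> \<open>Both minus signs of the left-hand side meet here: \<open>G\<close> at
      \<open>- x\<close> carries one, the reflected principal parts the other, so the transform of
      the difference is the constant \<open>- G 0\<close>.\<close>
    moreover have "G 0 = - laplace D' (of_real x) - ?P (- of_real x)"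
      using G2[of "- of_real x"] const[of "- of_real x"] x by simp
    then have "laplace D' (of_real x) + ?P (- of_real x) = - G 0" by simp
    ultimately show "(laplace_trunc (\<lambda>t. D' t - ?E' t) (of_real x) \<longlongrightarrow> - G 0) at_top"
      unfolding principal_parts_reflect by simp
  qed
  have "AE t in lebesgue. D t = ?E t"
    using pos AE_lebesgue_reflect[OF neg]
  proof eventually_elim
    case (elim t)
    then show ?case
      using exp_poly_reflect[of N p r c "- t"] by (cases "t \<ge> 0") (auto simp: D_def D'_def gl_def gr_def)
  qed
  then show ?thesis unfolding D_def exp_poly_def .
qed

end
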